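(* Suppose that the level set $\mathcal{X}=\{x\in\mathbb{R}^n:F(x)\le F(x^{(0)})\}$ is compact. Let $(x^{\star},y^{\star})$ be an accumulation point of the sequence $\{(x^{(t)},y^{(t)}):t\in\mathbb{N}\}$ generated by RMPGA. Then $x^{\star}\in\mathrm{dom}(F)$ is a critical point of $F$ with $F(x^{\star})y^{\star}\in F(x^{\star})\,\partial g(x^{\star})$ almost surely.
   Context: Setting. $f,g,h:\mathbb{R}^n\to(-\infty,+\infty]$ are proper lower semicontinuous functions, $\Omega:=\{x\in\mathbb{R}^n: g(x)\neq 0\}$ is nonempty, and $f$ is block-separable: $f(x)=\sum_{i=1}^N f_i(x_i)$, where the subvectors $x_i\in\mathbb{R}^{n_i}$ form a partition of the components of $x$ and each $f_i:\mathbb{R}^{n_i}\to(-\infty,+\infty]$ is proper lower semicontinuous. Standing assumptions: (a) $f$ is continuous on $\mathrm{dom}(f)$ and each $f_i$ is bounded below; (b) $h$ is locally Lipschitz differentiable on $\Omega$, i.e. every $x\in\Omega$ has a neighborhood $\mathcal{B}(x)$ and a constant $L_x$ with $\|\nabla h(u)-\nabla h(v)\|_2\le L_x\|u-v\|_2$ for all $u,v\in\mathcal{B}(x)\cap\Omega$; (c) $g$ is convex, real-valued and nonnegative on $\mathbb{R}^n$; (d) $f+h\ge 0$ on $\mathrm{dom}(f)$. Notation. $\mathrm{dom}(\varphi)=\{x:\varphi(x)<+\infty\}$; $g^*(y)=\sup_x\{\langle x,y\rangle-g(x)\}$; $\partial g$ is the convex subdifferential; $\nabla_ih$ is the partial gradient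 with respect to $x_i$; $\zeta(x):=f(x)+h(x)$; $\eta(x,y):=\langle x,y\rangle-g^*(y)$. $F(x)=\zeta(x)/g(x)$ if $x\in\Omega\cap\mathrm{dom}(f)$ and $F(x)=+\infty$ otherwise. $Q(x,y)=\zeta(x)/\eta(x,y)$ if $(x,y)\in\mathrm{dom}(f)\times\mathrm{dom}(g^* )$ and $\eta(x,y)>0$, and $Q(x,y)=+\infty$ otherwise. $\mathrm{prox}_{\varphi}(x)=\arg\min_z\{\varphi(z)+\frac12\|z-x\|_2^2\}$ (possibly set-valued). $[s]_+=\max\{0,s\}$. The Fréchet subdifferential of a proper $\varphi$ at $x\in\mathrm{dom}(\varphi)$ is $\widehat{\partial}\varphi(x)=\{y:\liminf_{z\to x,z\ne x}\frac{\varphi(z)-\varphi(x)-\langle y,z-x\rangle}{\|z-x\|_2}\ge0\}$. $x^{\star}\in\mathrm{dom}(F)$ is a critical point of $F$ if $0\in\widehat{\partial}f(x^{\star})+\nabla h(x^{\star})-F(x^{\star})\,\partial g(x^{\star})$. Algorithm MPGA. Input: $x^{(0)}\in\mathrm{dom}(F)$, $y^{(0)}\in\partial g(x^{(0)})$, reals $0<\underline{\alpha}\le\overline{\alpha}$, $\sigma>0$, $0<\gamma<1$, an integer $M\ge0$. For $t=0,1,2,\dots$: Step 1. Let $Q_{(t)}=Q(x^{(t)},y^{(t)})$ and $l(t)=\max\{j\le t:Q_{(j)}=\max\{Q_{(s)}:[t-M]_+\le s\le t\}\}$. Step 2. Pick $i\in\{0,1,\dots,N\}$ and an initial $\alpha\in[\underline{\alpha},\overline{\alpha}]$.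 Step 2-Y (if $i=0$): set $x^{(t+1)}=x^{(t)}$, $y^{(t+1)}=\mathrm{prox}_{\alpha g^*}(y^{(t)}+\alpha x^{(t)})$. Step 2-X (if $i\ge1$): compute $x_i^{(t)}(\alpha)\in\mathrm{prox}_{\alpha f_i}\big(x_i^{(t)}-\alpha\nabla_ih(x^{(t)})+\alpha Q_{(t)}y_i^{(t)}\big)$ (where $y_i^{(t)}$ is the $i$-th block of $y^{(t)}$) and let $x^{(t),i}(\alpha)$ be $x^{(t)}$ with its $i$-th block replaced by $x_i^{(t)}(\alpha)$. If $\zeta(x^{(t),i}(\alpha))+\frac{\sigma}{2}\|x^{(t),i}(\alpha)-x^{(t)}\|_2^2\le Q_{(l(t))}\,\eta(x^{(t),i}(\alpha),y^{(t)})$, set $(x^{(t+1)},y^{(t+1)})=(x^{(t),i}(\alpha),y^{(t)})$; otherwise replace $\alpha$ by $\alpha\gamma$ and repeat Step 2-X. Then go to the next $t$. RMPGA (randomized MPGA) is MPGA in which, at the $t$-th iteration, an index $i$ is picked from $\{0,1,\dots,N\}$ with probability $p_i^{(t)}\ge p_{\min}>0$, where $\{p_i^{(t)}:i=0,\dots,N\}$ forms a probability distribution. *)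

theory Defs
  imports "HOL-Probability.Probability"
begin

section \<open>Extended-real-valued functions\<close>

text \<open>
  The set argument is the underlying space: \<open>UNIV\<close> for functions on the whole space, a
  coordinate subspace for the blocks of a separable function (see below).
\<close>

definition proper_on :: "'a set \<Rightarrow> ('a \<Rightarrow> ereal) \<Rightarrow> bool" where
  "proper_on S \<phi> \<longleftrightarrow> (\<forall>x\<in>S. \<phi> x \<noteq> -\<infinity>) \<and> (\<exists>x\<in>S. \<phi> x \<noteq> \<infinity>)"

definition lsc_on :: "'a::topological_space set \<Rightarrow> ('a \<Rightarrow> ereal) \<Rightarrow> bool" where
  "lsc_on S \<phi> \<longleftrightarrow> (\<forall>x\<in>S. \<phi> x \<le> Liminf (at x within S) \<phi>)"

definition edom :: "('a \<Rightarrow> ereal) \<Rightarrow> 'a set" where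
  "edom \<phi> = {x. \<phi> x < \<infinity>}"

definition prox_on :: "'a::real_normed_vector set \<Rightarrow> ('a \<Rightarrow> ereal) \<Rightarrow> 'a \<Rightarrow> 'a set" where
  "prox_on S \<phi> u = {z. is_arg_min (\<lambda>w. \<phi> w + ereal (1/2 * (norm (w - u))\<^sup>2)) (\<lambda>w. w \<in> S) z}"

definition conjugate :: "('a::real_inner \<Rightarrow> real) \<Rightarrow> 'a \<Rightarrow> ereal" where
  "conjugate g y = (SUP x. ereal (x \<bullet> y - g x))"

definition subdiff :: "('a::real_inner \<Rightarrow> real) \<Rightarrow> 'a \<Rightarrow> 'a set" where
  "subdiff g x = {v. \<forall>z. g x + v \<bullet> (z - x) \<le> g z}"

definition frechet_subdiff :: "('a::real_inner \<Rightarrow> ereal) \<Rightarrow> 'a \<Rightarrow> 'a set" where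
  "frechet_subdiff \<phi> x = {v. x \<in> edom \<phi> \<and>
     0 \<le> Liminf (at x) (\<lambda>z. (\<phi> z - \<phi> x - ereal (v \<bullet> (z - x))) / ereal (norm (z - x)))}"

text \<open>The gradient is only meaningful at points near which \<open>h\<close> is finite and where it is
  differentiable.\<close>

definition grad :: "('a::real_inner \<Rightarrow> ereal) \<Rightarrow> 'a \<Rightarrow> 'a" where
  "grad h x = (THE d. GDERIV (\<lambda>u. real_of_ereal (h u)) x :> d)"

definition loc_lipschitz_differentiable_on :: "'a::real_inner set \<Rightarrow> ('a \<Rightarrow> ereal) \<Rightarrow> bool" where
  "loc_lipschitz_differentiable_on S h \<longleftrightarrow>
     (\<forall>x\<in>S. \<bar>h x\<bar> \<noteq> \<infinity> \<and> (\<exists>d. GDERIV (\<lambda>u. real_of_ereal (h u)) x :> d)) \<and>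
     (\<forall>x\<in>S. \<exists>U L. open U \<and> x \<in> U \<and>
        (\<forall>u\<in>U \<inter> S. \<forall>v\<in>U \<inter> S. norm (grad h u - grad h v) \<le> L * norm (u - v)))"


section \<open>Blocks of coordinates\<close>

text \<open>
  A block is a set \<open>I\<close> of coordinates. The space of subvectors indexed by \<open>I\<close> is identified with
  the coordinate subspace \<open>coord_space I\<close> (pad with zeros), which has dimension \<open>card I\<close> and carries
  the same Euclidean norm; a function of the subvector is a function on that subspace, and its
  values off the subspace are never used.
\<close>

definition coord_space :: "'n::finite set \<Rightarrow> (real^'n) set" where
  "coord_space I = {z. \<forall>j. j \<notin> I \<longrightarrow> z $ j = 0}"

definition subvec :: "'n::finite set \<Rightarrow> real^'n \<Rightarrow> real^'n" where
  "subvec I x = (\<chi> j. if j \<in> I then x $ j else 0)"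

definition replace_block :: "'n::finite set \<Rightarrow> real^'n \<Rightarrow> real^'n \<Rightarrow> real^'n" where
  "replace_block I z x = (\<chi> j. if j \<in> I then z $ j else x $ j)"

definition coord_partition :: "nat \<Rightarrow> (nat \<Rightarrow> 'n::finite set) \<Rightarrow> bool" where
  "coord_partition N B \<longleftrightarrow>
     disjoint_family_on B {1..N} \<and> (\<Union>i\<in>{1..N}. B i) = UNIV \<and> (\<forall>i\<in>{1..N}. B i \<noteq> {})"


section \<open>The fractional program\<close>

definition Omega :: "('a \<Rightarrow> real) \<Rightarrow> 'a set" where
  "Omega g = {x. g x \<noteq> 0}"

definition zeta :: "('a \<Rightarrow> ereal) \<Rightarrow> ('a \<Rightarrow> ereal) \<Rightarrow> 'a \<Rightarrow> ereal" where
  "zeta f h x = f x + h x"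

definition eta :: "('a::real_inner \<Rightarrow> real) \<Rightarrow> 'a \<Rightarrow> 'a \<Rightarrow> ereal" where
  "eta g x y = ereal (x \<bullet> y) - conjugate g y"

definition Fobj :: "('a \<Rightarrow> ereal) \<Rightarrow> ('a \<Rightarrow> real) \<Rightarrow> ('a \<Rightarrow> ereal) \<Rightarrow> 'a \<Rightarrow> ereal" where
  "Fobj f g h x = (if x \<in> Omega g \<inter> edom f then zeta f h x / ereal (g x) else \<infinity>)"

definition Qobj ::
  "('a::real_inner \<Rightarrow> ereal) \<Rightarrow> ('a \<Rightarrow> real) \<Rightarrow> ('a \<Rightarrow> ereal) \<Rightarrow> 'a \<Rightarrow> 'a \<Rightarrow> ereal" where
  "Qobj f g h x y =
     (if (x, y) \<in> edom f \<times> edom (conjugate g) \<and> eta g x y > 0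
      then zeta f h x / eta g x y else \<infinity>)"

definition critical_point ::
  "('a::real_inner \<Rightarrow> ereal) \<Rightarrow> ('a \<Rightarrow> real) \<Rightarrow> ('a \<Rightarrow> ereal) \<Rightarrow> 'a \<Rightarrow> bool" where
  "critical_point f g h x \<longleftrightarrow> x \<in> edom (Fobj f g h) \<and>
     0 \<in> {u + grad h x - real_of_ereal (Fobj f g h x) *\<^sub>R v | u v.
            u \<in> frechet_subdiff f x \<and> v \<in> subdiff g x}"


section \<open>The algorithm\<close>

text \<open>For a sequence \<open>q\<close> of values, truncated subtraction on \<open>nat\<close> gives \<open>[t - m]\<^sub>+\<close>.\<close>

definition last_max_index :: "nat \<Rightarrow> (nat \<Rightarrow> ereal) \<Rightarrow> nat \<Rightarrow> nat" where
  "last_max_index m q t = Max {j. j \<le> t \<and> q j = Max (q ` {t - m..t})}"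

definition step_Y ::
  "('a::real_inner \<Rightarrow> real) \<Rightarrow> real \<Rightarrow> 'a \<times> 'a \<Rightarrow> 'a \<times> 'a \<Rightarrow> bool" where
  "step_Y g \<alpha> = (\<lambda>(x, y) (x', y').
     x' = x \<and> y' \<in> prox_on UNIV (\<lambda>w. ereal \<alpha> * conjugate g w) (y + \<alpha> *\<^sub>R x))"

text \<open>Line-search test for the trial point \<open>x'\<close>; \<open>ql\<close> is the reference value \<open>Q_(l(t))\<close>.\<close>

definition accepts ::
  "('a::real_inner \<Rightarrow> ereal) \<Rightarrow> ('a \<Rightarrow> real) \<Rightarrow> ('a \<Rightarrow> ereal) \<Rightarrow> real \<Rightarrow> ereal \<Rightarrow> 'a \<Rightarrow> 'a \<Rightarrow> 'a \<Rightarrow> bool" where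
  "accepts f g h \<sigma> ql x y x' \<longleftrightarrow>
     zeta f h x' + ereal (\<sigma> / 2 * (norm (x' - x))\<^sup>2) \<le> ql * eta g x' y"

text \<open>
  \<open>z k\<close> is the candidate for the block \<open>I\<close> computed in the \<open>k\<close>-th pass of the backtracking loop,
  with step size \<open>\<alpha> * \<gamma> ^ k\<close>; the loop stops at the first accepted pass \<open>K\<close>. The current value
  \<open>q\<close> is finite along every run, so that \<open>real_of_ereal q\<close> is its genuine value.
\<close>

definition step_X ::
  "('n::finite) set \<Rightarrow> (real^'n \<Rightarrow> ereal) \<Rightarrow> (real^'n \<Rightarrow> ereal) \<Rightarrow> (real^'n \<Rightarrow> real) \<Rightarrow>
   (real^'n \<Rightarrow> ereal) \<Rightarrow> real \<Rightarrow> real \<Rightarrow> real \<Rightarrow> ereal \<Rightarrow> ereal \<Rightarrow>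
   (real^'n) \<times> (real^'n) \<Rightarrow> (real^'n) \<times> (real^'n) \<Rightarrow> bool" where
  "step_X I fI f g h \<sigma> \<gamma> \<alpha> q ql = (\<lambda>(x, y) (x', y').
     \<exists>(z :: nat \<Rightarrow> real^'n) K.
       (\<forall>k\<le>K. z k \<in> prox_on (coord_space I) (\<lambda>w. ereal (\<alpha> * \<gamma> ^ k) * fI w)
                (subvec I x - (\<alpha> * \<gamma> ^ k) *\<^sub>R subvec I (grad h x)
                  + (\<alpha> * \<gamma> ^ k * real_of_ereal q) *\<^sub>R subvec I y)) \<and>
       (\<forall>k<K. \<not> accepts f g h \<sigma> ql x y (replace_block I (z k) x)) \<and>
       accepts f g h \<sigma> ql x y (replace_block I (z K) x) \<and>
       x' = replace_block I (z K) x \<and> y' = y)"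

text \<open>
  \<open>(x t, y t)\<close> is a sequence generated by the algorithm when the indices picked are \<open>i t\<close>. The
  initial step sizes and the elements of the set-valued proximity operators are arbitrary.
\<close>

definition MPGA_run ::
  "nat \<Rightarrow> (nat \<Rightarrow> 'n::finite set) \<Rightarrow> (nat \<Rightarrow> real^'n \<Rightarrow> ereal) \<Rightarrow> (real^'n \<Rightarrow> ereal) \<Rightarrow>
   (real^'n \<Rightarrow> real) \<Rightarrow> (real^'n \<Rightarrow> ereal) \<Rightarrow> real \<Rightarrow> real \<Rightarrow> real \<Rightarrow> real \<Rightarrow> nat \<Rightarrow>
   real^'n \<Rightarrow> real^'n \<Rightarrow> (nat \<Rightarrow> nat) \<Rightarrow> (nat \<Rightarrow> real^'n) \<Rightarrow> (nat \<Rightarrow> real^'n) \<Rightarrow> bool" where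
  "MPGA_run N B fb f g h \<alpha>lo \<alpha>hi \<sigma> \<gamma> m x0 y0 i x y \<longleftrightarrow>
     x 0 = x0 \<and> y 0 = y0 \<and>
     (\<forall>t. i t \<in> {0..N} \<and>
       (let q = (\<lambda>s. Qobj f g h (x s) (y s)); l = last_max_index m q t in
        \<exists>\<alpha>\<in>{\<alpha>lo..\<alpha>hi}.
          if i t = 0 then step_Y g \<alpha> (x t, y t) (x (Suc t), y (Suc t))
          else step_X (B (i t)) (fb (i t)) f g h \<sigma> \<gamma> \<alpha> (q t) (q l)
                 (x t, y t) (x (Suc t), y (Suc t))))"

text \<open>
  Random picks: \<open>\<F> t\<close> is the information available before the pick of iteration \<open>t\<close> (it
  contains at least \<open>x 0, y 0, i 0, \<dots>, i (t - 1), x t, y t\<close>), and given that information the index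
  \<open>j\<close> is picked with the prescribed probability \<open>p t j\<close>. Step sizes and proximal points may also
  be random, but they cannot anticipate later picks.
\<close>

definition RMPGA_process ::
  "'w measure \<Rightarrow> (nat \<Rightarrow> 'w measure) \<Rightarrow> nat \<Rightarrow> (nat \<Rightarrow> nat \<Rightarrow> real) \<Rightarrow>
   (nat \<Rightarrow> 'w \<Rightarrow> nat) \<Rightarrow> (nat \<Rightarrow> 'w \<Rightarrow> 'a::topological_space) \<Rightarrow> (nat \<Rightarrow> 'w \<Rightarrow> 'a) \<Rightarrow> bool" where
  "RMPGA_process P \<F> N p i x y \<longleftrightarrow>
     filtration (space P) \<F> \<and> (\<forall>t. subalgebra P (\<F> t)) \<and>
     (\<forall>t. x t \<in> borel_measurable (\<F> t) \<and> y t \<in> borel_measurable (\<F> t) \<and>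
          i t \<in> measurable (\<F> (Suc t)) (count_space UNIV)) \<and>
     (\<forall>t. \<forall>j\<in>{0..N}. AE \<omega> in P.
        real_cond_exp P (\<F> t) (indicator {\<omega>' \<in> space P. i t \<omega>' = j}) \<omega> = p t j)"

end

theory Submission
  imports Defs
begin

text \<open>
  Almost surely, whenever the iterates visit an open set infinitely often, they do so infinitely
  often at times \<open>t\<close> at which the picks are \<open>j, 0, \<dots>, 0\<close> with \<open>M\<close> trailing zeros, for every block
  index \<open>j\<close>. Steps of type Y never increase \<open>Q\<close>, so after such a pattern the reference value
  \<open>Q_(l(t + M + 1))\<close> is at most \<open>Q_(t + 1)\<close>. As \<open>Q_(l(t))\<close> decreases to a limit \<open>Q*\<close>, the decrease of
  \<open>Q\<close> obtained in the first step of the pattern tends to zero along these times, no matter how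
  nonmonotone the line search is elsewhere.

  Choose the times so that the iterates converge to the given accumulation point \<open>(x*, y*)\<close>. If
  \<open>Q* = 0\<close> then \<open>f + h\<close> attains its minimum \<open>0\<close> at \<open>x*\<close>. Otherwise \<open>j = 0\<close> yields
  \<open>\<eta>(x, y) \<rightarrow> g(x*)\<close>, hence \<open>y* \<in> \<partial>g(x*)\<close> and \<open>F(x*) = Q*\<close>; and \<open>j \<ge> 1\<close> yields
  \<open>x(t + 1) - x(t) \<rightarrow> 0\<close>, so that the proximal inequality of block \<open>j\<close> passes to the limit, the
  accepted step sizes being bounded away from zero near \<open>x*\<close>. Summing over the blocks gives
  criticality.
\<close>

section \<open>Recurrence of patterns of picks\<close>

context prob_space
begin

text \<open>Conditional Borel--Cantelli, by Fatou's lemma for the supermartingale that is multiplied by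
  \<open>1 / (1 - p)\<close> at each failed trial and drops to zero at a success.\<close>

lemma AE_trials_imp_success:
  fixes \<F> :: "nat \<Rightarrow> 'a measure" and E S :: "nat \<Rightarrow> 'a set"
  assumes sub: "\<And>t. subalgebra M (\<F> t)"
    and mono: "\<And>s t. s \<le> t \<Longrightarrow> sets (\<F> s) \<subseteq> sets (\<F> t)"
    and E: "\<And>t. E t \<in> sets (\<F> t)" and S: "\<And>t. S t \<in> sets (\<F> (Suc t))"
    and p: "0 < p" "p < 1"
    and ce: "\<And>t. AE \<omega> in M. p \<le> real_cond_exp M (\<F> t) (indicator (S t)) \<omega>"
  shows "AE \<omega> in M. (\<exists>\<^sub>\<infinity>t. \<omega> \<in> E t) \<longrightarrow> (\<exists>t. \<omega> \<in> E t \<inter> S t)"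
proof -
  define c where "c = 1 / (1 - p)"
  have c: "c > 1" "c * (1 - p) = 1" using p by (auto simp: c_def)
  define W :: "nat \<Rightarrow> 'a \<Rightarrow> real" where
    "W = rec_nat (\<lambda>_. 1) (\<lambda>k w \<omega>. w \<omega> * (1 - indicator (E k) \<omega> + c * (indicator (E k) \<omega> * (1 - indicator (S k) \<omega>))))"
  have W0: "W 0 \<omega> = 1" for \<omega> by (simp add: W_def)
  have WS: "W (Suc k) \<omega> = W k \<omega> * (1 - indicator (E k) \<omega> + c * (indicator (E k) \<omega> * (1 - indicator (S k) \<omega>)))"
    for k \<omega> by (simp add: W_def)
  have Wnn: "0 \<le> W k \<omega>" for k \<omega>
    using c by (induction k) (auto simp: W0 WS indicator_def)
  have Wle: "W k \<omega> \<le> c ^ k" for k \<omega>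
  proof (induction k)
    case (Suc k)
    have "W (Suc k) \<omega> \<le> W k \<omega> * c"
      unfolding WS using c Wnn by (intro mult_left_mono) (auto simp: indicator_def)
    also have "\<dots> \<le> c ^ k * c" using Suc c by (intro mult_right_mono) auto
    finally show ?case by (simp add: mult.commute)
  qed (simp add: W0)
  have Wmeas: "W k \<in> borel_measurable (\<F> k)" for k
  proof (induction k)
    case 0
    have "W 0 = (\<lambda>_. 1)" by (simp add: W0 fun_eq_iff)
    then show ?case by simp
  next
    case (Suc k)
    have *: "subalgebra (\<F> (Suc k)) (\<F> k)"
      using sub[of k] sub[of "Suc k"] mono[of k "Suc k"] by (auto simp: subalgebra_def)
    have [measurable]: "W k \<in> borel_measurable (\<F> (Suc k))"
      using measurable_from_subalg[OF * Suc] .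
    have [measurable]: "E k \<in> sets (\<F> (Suc k))" "S k \<in> sets (\<F> (Suc k))"
      using E[of k] mono[of k "Suc k"] S[of k] by auto
    have "W (Suc k) = (\<lambda>\<omega>. W k \<omega> * (1 - indicator (E k) \<omega> + c * (indicator (E k) \<omega> * (1 - indicator (S k) \<omega>))))"
      by (simp add: WS fun_eq_iff)
    then show ?case by simp
  qed
  have WM[measurable]: "W k \<in> borel_measurable M" for k
    using measurable_from_subalg[OF sub Wmeas] .
  have EM[measurable]: "E k \<in> sets M" "S k \<in> sets M" for k
    using E[of k] S[of k] sub[of k] sub[of "Suc k"] by (auto simp: subalgebra_def)
  \<comment> \<open>The bound \<open>c ^ k\<close> on \<open>W k\<close> makes every product below
    integrable on the probability space.\<close>
  have int: "integrable M (\<lambda>\<omega>. W k \<omega> * h \<omega>)" if "h \<in> borel_measurable M" "\<And>\<omega>. \<bar>h \<omega>\<bar> \<le> 1" for k h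
  proof (rule integrable_const_bound)
    show "AE \<omega> in M. norm (W k \<omega> * h \<omega>) \<le> c ^ k"
    proof (rule AE_I2)
      fix \<omega>
      have "W k \<omega> * \<bar>h \<omega>\<bar> \<le> c ^ k * 1"
        using Wle Wnn that(2) c by (intro mult_mono) auto
      then show "norm (W k \<omega> * h \<omega>) \<le> c ^ k" using Wnn by (simp add: abs_mult)
    qed
  qed (use that in measurable)
  have Wint: "integrable M (W k)" for k using int[of "\<lambda>_. 1" k] by simp
  \<comment> \<open>Supermartingale property in integrated form. \<open>W k\<close> times the
    indicator of \<open>E k\<close> is known at time \<open>k\<close>, so \<open>S k\<close> may be
    replaced under the integral by its conditional probability, which is at least \<open>p\<close>.
    The surviving coefficient \<open>c * (1 - p) - 1\<close> is zero by the choice of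
    \<open>c\<close>.\<close>
  have step: "(\<integral>\<omega>. W (Suc k) \<omega> \<partial>M) \<le> (\<integral>\<omega>. W k \<omega> \<partial>M)" for k
  proof -
    interpret finite_measure_subalgebra M "\<F> k"
      by unfold_locales (rule sub)
    have i1: "integrable M (\<lambda>\<omega>. W k \<omega> * indicator (E k) \<omega>)"
      by (rule int) (auto simp: indicator_def)
    have i2: "integrable M (\<lambda>\<omega>. W k \<omega> * (indicator (E k) \<omega> * indicator (S k) \<omega>))"
      by (rule int) (auto simp: indicator_def)
    have i2': "integrable M (\<lambda>\<omega>. (W k \<omega> * indicator (E k) \<omega>) * indicator (S k) \<omega>)"
      using i2 by (simp add: mult.assoc)
    have mk: "(\<lambda>\<omega>. W k \<omega> * indicator (E k) \<omega>) \<in> borel_measurable (\<F> k)"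
      using Wmeas[of k] E[of k] by measurable
    note ci = real_cond_exp_intg[OF i2' mk borel_measurable_indicator[OF EM(2)]]
    have "(\<integral>\<omega>. p * (W k \<omega> * indicator (E k) \<omega>) \<partial>M)
        \<le> (\<integral>\<omega>. (W k \<omega> * indicator (E k) \<omega>) * real_cond_exp M (\<F> k) (indicator (S k)) \<omega> \<partial>M)"
    proof (rule integral_mono_AE)
      show "AE \<omega> in M. p * (W k \<omega> * indicator (E k) \<omega>)
          \<le> W k \<omega> * indicator (E k) \<omega> * real_cond_exp M (\<F> k) (indicator (S k)) \<omega>"
        using ce[of k]
      proof eventually_elim
        case (elim \<omega>)
        then show ?case
          using mult_left_mono[OF elim, of "W k \<omega> * indicator (E k) \<omega>"] Wnn[of k \<omega>]
          by (simp add: mult.commute)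
      qed
    qed (use i1 ci in auto)
    then have le: "p * (\<integral>\<omega>. W k \<omega> * indicator (E k) \<omega> \<partial>M)
        \<le> (\<integral>\<omega>. W k \<omega> * (indicator (E k) \<omega> * indicator (S k) \<omega>) \<partial>M)"
      using ci by (simp add: mult.assoc)
    have "(\<integral>\<omega>. W (Suc k) \<omega> \<partial>M) = (\<integral>\<omega>. W k \<omega> + (c - 1) * (W k \<omega> * indicator (E k) \<omega>)
        - c * (W k \<omega> * (indicator (E k) \<omega> * indicator (S k) \<omega>)) \<partial>M)"
      by (rule Bochner_Integration.integral_cong) (auto simp: WS algebra_simps)
    also have "\<dots> = (\<integral>\<omega>. W k \<omega> \<partial>M) + (c - 1) * (\<integral>\<omega>. W k \<omega> * indicator (E k) \<omega> \<partial>M)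
        - c * (\<integral>\<omega>. W k \<omega> * (indicator (E k) \<omega> * indicator (S k) \<omega>) \<partial>M)"
      using i1 i2 Wint by simp
    also have "\<dots> \<le> (\<integral>\<omega>. W k \<omega> \<partial>M) + (c - 1) * (\<integral>\<omega>. W k \<omega> * indicator (E k) \<omega> \<partial>M)
        - c * (p * (\<integral>\<omega>. W k \<omega> * indicator (E k) \<omega> \<partial>M))"
      using le c by simp
    also have "\<dots> = (\<integral>\<omega>. W k \<omega> \<partial>M) + (c * (1 - p) - 1) * (\<integral>\<omega>. W k \<omega> * indicator (E k) \<omega> \<partial>M)"
      by (simp add: algebra_simps)
    finally show ?thesis using c by simp
  qed
  have "(\<integral>\<omega>. W k \<omega> \<partial>M) \<le> 1" for k
  proof (induction k)
    case 0
    show ?case by (simp add: W0 prob_space)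
  qed (use step in \<open>meson order_trans\<close>)
  then have "(\<integral>\<^sup>+\<omega>. ennreal (W k \<omega>) \<partial>M) \<le> 1" for k
    using Wint Wnn by (subst nn_integral_eq_integral) (auto simp: ennreal_le_1)
  then have "liminf (\<lambda>k. \<integral>\<^sup>+\<omega>. ennreal (W k \<omega>) \<partial>M) \<le> 1"
    by (intro Liminf_le) auto
  then have "(\<integral>\<^sup>+\<omega>. liminf (\<lambda>k. ennreal (W k \<omega>)) \<partial>M) \<le> 1"
    by (intro order_trans[OF nn_integral_liminf]) auto
  then have "(\<integral>\<^sup>+\<omega>. liminf (\<lambda>k. ennreal (W k \<omega>)) \<partial>M) \<noteq> \<infinity>"
    by (auto simp: top_unique)
  then have "AE \<omega> in M. liminf (\<lambda>k. ennreal (W k \<omega>)) \<noteq> \<infinity>"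
    by (intro nn_integral_PInf_AE) auto
  then show ?thesis
  proof eventually_elim
    case (elim \<omega>)
    show ?case
    proof (intro impI, rule ccontr)
      assume inf: "\<exists>\<^sub>\<infinity>t. \<omega> \<in> E t" and "\<nexists>t. \<omega> \<in> E t \<inter> S t"
      \<comment> \<open>Without a success the weight grows by the factor \<open>c > 1\<close> at
        each of infinitely many trials, so its liminf exceeds every power of \<open>c\<close>,
        against the finiteness that Fatou's lemma gives.\<close>
      then have Wc: "W (Suc k) \<omega> = W k \<omega> * (if \<omega> \<in> E k then c else 1)" for k
        by (auto simp: WS indicator_def)
      have Wpos: "W k \<omega> \<ge> 0" for k by (rule Wnn)
      have "incseq (\<lambda>k. W k \<omega>)"
        using c mult_left_mono[OF _ Wpos, of 1 c] by (intro incseq_SucI) (auto simp: Wc)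
      then have mn: "W k \<omega> \<le> W l \<omega>" if "k \<le> l" for k l using that by (auto simp: incseq_def)
      have ex: "\<exists>t. c ^ K \<le> W t \<omega>" for K
      proof (induction K)
        case 0
        show ?case by (intro exI[of _ 0]) (simp add: W0)
      next
        case (Suc K)
        then obtain t where t: "c ^ K \<le> W t \<omega>" by blast
        obtain s where s: "s \<ge> t" "\<omega> \<in> E s" using inf unfolding INFM_nat_le by blast
        have "c ^ Suc K \<le> W (Suc s) \<omega>"
          using t s mn[OF s(1)] c by (simp add: Wc mult.commute)
        then show ?case by blast
      qed
      have "ennreal (c ^ K) \<le> liminf (\<lambda>k. ennreal (W k \<omega>))" for K
      proof -
        obtain t where "c ^ K \<le> W t \<omega>" using ex by blast
        then show ?thesis
          by (intro Liminf_bounded eventually_sequentiallyI[of t] ennreal_leI)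
            (meson mn order_trans)
      qed
      moreover obtain r where "0 \<le> r" "liminf (\<lambda>k. ennreal (W k \<omega>)) = ennreal r"
        using elim by (cases "liminf (\<lambda>k. ennreal (W k \<omega>))") auto
      moreover obtain K where "r < c ^ K" using real_arch_pow[OF c(1)] by blast
      ultimately show False by (metis ennreal_le_iff not_le)
    qed
  qed
qed

text \<open>Applying the previous lemma to every tail of the sequence yields a success after each
  time \<open>n\<close>; countably many null sets are discarded.\<close>

lemma AE_trials_imp_successes:
  fixes \<F> :: "nat \<Rightarrow> 'a measure" and E S :: "nat \<Rightarrow> 'a set"
  assumes sub: "\<And>t. subalgebra M (\<F> t)"
    and mono: "\<And>s t. s \<le> t \<Longrightarrow> sets (\<F> s) \<subseteq> sets (\<F> t)"
    and E: "\<And>t. E t \<in> sets (\<F> t)" and S: "\<And>t. S t \<in> sets (\<F> (Suc t))"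
    and p: "0 < p"
    and ce: "\<And>t. AE \<omega> in M. p \<le> real_cond_exp M (\<F> t) (indicator (S t)) \<omega>"
  shows "AE \<omega> in M. (\<exists>\<^sub>\<infinity>t. \<omega> \<in> E t) \<longrightarrow> (\<exists>\<^sub>\<infinity>t. \<omega> \<in> E t \<inter> S t)"
proof -
  \<comment> \<open>The previous lemma divides by \<open>1 - p\<close>, so the bound is lowered
    below 1; a smaller lower bound remains valid.\<close>
  define p' where "p' = min p (1/2)"
  have p': "0 < p'" "p' < 1" "p' \<le> p" using p by (auto simp: p'_def)
  have "AE \<omega> in M. (\<exists>\<^sub>\<infinity>t. \<omega> \<in> E (t + n)) \<longrightarrow> (\<exists>t. \<omega> \<in> E (t + n) \<inter> S (t + n))" for n
  proof (rule AE_trials_imp_success[where \<F> = "\<lambda>t. \<F> (t + n)" and p = p'])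
    show "AE \<omega> in M. p' \<le> real_cond_exp M (\<F> (t + n)) (indicator (S (t + n))) \<omega>" for t
      using ce[of "t + n"] by eventually_elim (use p' in linarith)
  qed (use sub mono E S[of "_ + n"] p' in auto)
  then have "AE \<omega> in M. \<forall>n. (\<exists>\<^sub>\<infinity>t. \<omega> \<in> E (t + n)) \<longrightarrow> (\<exists>t. \<omega> \<in> E (t + n) \<inter> S (t + n))"
    by (simp add: AE_all_countable)
  then show ?thesis
  proof eventually_elim
    case (elim \<omega>)
    show ?case
    proof
      assume inf: "\<exists>\<^sub>\<infinity>t. \<omega> \<in> E t"
      have "\<exists>\<^sub>\<infinity>t. \<omega> \<in> E (t + n)" for n
        unfolding INFM_nat_le
      proof
        fix k
        obtain s where "s \<ge> k + n" "\<omega> \<in> E s" using inf unfolding INFM_nat_le by blast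
        then show "\<exists>t\<ge>k. \<omega> \<in> E (t + n)" by (intro exI[of _ "s - n"]) auto
      qed
      then have "\<exists>t. \<omega> \<in> E (t + n) \<inter> S (t + n)" for n using elim by blast
      then show "\<exists>\<^sub>\<infinity>t. \<omega> \<in> E t \<inter> S t"
        unfolding INFM_nat_le by (metis le_add2)
    qed
  qed
qed

text \<open>Induction on the pattern length: completing the first \<open>n\<close> successes counts
  as a new trial, and the next required pick decides its success.\<close>

lemma AE_trials_imp_successive_successes:
  fixes \<F> :: "nat \<Rightarrow> 'a measure" and E :: "nat \<Rightarrow> 'a set" and S :: "nat \<Rightarrow> nat \<Rightarrow> 'a set"
  assumes sub: "\<And>t. subalgebra M (\<F> t)"
    and mono: "\<And>s t. s \<le> t \<Longrightarrow> sets (\<F> s) \<subseteq> sets (\<F> t)"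
    and E: "\<And>t. E t \<in> sets (\<F> t)" and S: "\<And>k t. S k t \<in> sets (\<F> (Suc t))"
    and p: "0 < p"
    and ce: "\<And>k t. AE \<omega> in M. p \<le> real_cond_exp M (\<F> t) (indicator (S k t)) \<omega>"
  shows "AE \<omega> in M. (\<exists>\<^sub>\<infinity>t. \<omega> \<in> E t) \<longrightarrow> (\<exists>\<^sub>\<infinity>t. \<omega> \<in> E t \<and> (\<forall>k<n. \<omega> \<in> S k (t + k)))"
proof (induction n)
  case (Suc n)
  \<comment> \<open>\<open>E'\<close> is indexed by the end of the partial pattern, not its start.
    This makes it known at time \<open>t\<close>, exactly when \<open>S n t\<close> is about to be
    decided. The guard \<open>t < n\<close> keeps truncated subtraction from inventing
    patterns.\<close>
  define E' where "E' = (\<lambda>t. if t < n then {} else E (t - n) \<inter> (\<Inter>k<n. S k (t - n + k)))"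
  have E': "E' t \<in> sets (\<F> t)" for t
  proof (cases "t < n")
    case False
    have "E (t - n) \<in> sets (\<F> t)" using E[of "t - n"] mono[of "t - n" t] by auto
    moreover have "S k (t - n + k) \<in> sets (\<F> t)" if "k < n" for k
    proof -
      have "Suc (t - n + k) \<le> t" using that False by simp
      then show ?thesis using S[of k "t - n + k"] mono by blast
    qed
    ultimately have "(\<Inter>k\<in>{..n}. if k = n then E (t - n) else S k (t - n + k)) \<in> sets (\<F> t)"
      by (intro sets.finite_INT) auto
    moreover have "E' t = (\<Inter>k\<in>{..n}. if k = n then E (t - n) else S k (t - n + k))"
      using False by (auto simp: E'_def le_less)
    ultimately show ?thesis by simp
  qed (simp add: E'_def)
  have *: "AE \<omega> in M. (\<exists>\<^sub>\<infinity>t. \<omega> \<in> E' t) \<longrightarrow> (\<exists>\<^sub>\<infinity>t. \<omega> \<in> E' t \<inter> S n t)"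
    by (rule AE_trials_imp_successes[where \<F> = \<F> and p = p]) (use sub mono E' S p ce in auto)
  have shift: "(\<exists>\<^sub>\<infinity>t. Q t \<and> n \<le> t) \<longleftrightarrow> (\<exists>\<^sub>\<infinity>t. Q (t + n))" for Q
    unfolding INFM_nat_le
  proof safe
    fix k assume "\<forall>k. \<exists>t\<ge>k. Q t \<and> n \<le> t"
    then obtain t where "t \<ge> k + n" "Q t" by blast
    then show "\<exists>t\<ge>k. Q (t + n)" by (intro exI[of _ "t - n"]) auto
  next
    fix k assume "\<forall>k. \<exists>t\<ge>k. Q (t + n)"
    then show "\<exists>t\<ge>k. Q t \<and> n \<le> t" by (meson le_add2 trans_le_add1)
  qed
  from * Suc show ?case
  proof eventually_elim
    case (elim \<omega>)
    have E'_iff: "\<omega> \<in> E' t \<longleftrightarrow> (\<omega> \<in> E (t - n) \<and> (\<forall>k<n. \<omega> \<in> S k (t - n + k))) \<and> n \<le> t" for t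
      by (auto simp: E'_def)
    show ?case
    proof
      assume "\<exists>\<^sub>\<infinity>t. \<omega> \<in> E t"
      then have "\<exists>\<^sub>\<infinity>t. \<omega> \<in> E' t"
        using elim shift[of "\<lambda>t. \<omega> \<in> E (t - n) \<and> (\<forall>k<n. \<omega> \<in> S k (t - n + k))"]
        by (simp add: E'_iff)
      then have "\<exists>\<^sub>\<infinity>t. (\<omega> \<in> E (t - n) \<and> (\<forall>k<n. \<omega> \<in> S k (t - n + k)) \<and> \<omega> \<in> S n t) \<and> n \<le> t"
        using elim by (auto simp: E'_iff conj_ac)
      then show "\<exists>\<^sub>\<infinity>t. \<omega> \<in> E t \<and> (\<forall>k<Suc n. \<omega> \<in> S k (t + k))"
        unfolding shift by (auto simp: less_Suc_eq elim!: frequently_elim1)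
    qed
  qed
qed simp

end

section \<open>Subgradients and conjugates\<close>

text \<open>A supporting hyperplane of the epigraph at \<open>(x, g x)\<close> cannot be vertical
  because \<open>g\<close> is finite everywhere; its normalised slope is a subgradient.\<close>

lemma subgradient_exists:
  fixes g :: "'a::euclidean_space \<Rightarrow> real"
  assumes "convex_on UNIV g"
  shows "subdiff g x \<noteq> {}"
proof -
  let ?S = "epigraph UNIV g"
  have "(x, g x) \<notin> interior ?S"
  proof
    assume "(x, g x) \<in> interior ?S"
    then obtain e where e: "e > 0" "ball (x, g x) e \<subseteq> ?S" by (auto simp: mem_interior)
    have "(x, g x - e / 2) \<in> ball (x, g x) e" using e by (simp add: dist_Pair_Pair dist_real_def)
    then show False using e by (auto simp: epigraph_def)
  qed
  \<comment> \<open>A nonempty interior makes interior and relative interior agree, so a boundary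
    point is also a relative boundary point. Continuity of \<open>g\<close> makes the strict
    epigraph an open subset.\<close>
  moreover have "interior ?S \<noteq> {}"
  proof -
    have "continuous_on UNIV g" using convex_on_continuous assms by blast
    then have "open {z :: 'a \<times> real. g (fst z) < snd z}"
      by (intro open_Collect_less continuous_on_compose2[of UNIV g _ fst] continuous_intros) auto
    moreover have "{z :: 'a \<times> real. g (fst z) < snd z} \<subseteq> ?S" by (auto simp: epigraph_def)
    ultimately have "{z :: 'a \<times> real. g (fst z) < snd z} \<subseteq> interior ?S" by (rule interior_maximal[rotated])
    moreover have "(x, g x + 1) \<in> {z :: 'a \<times> real. g (fst z) < snd z}" by simp
    ultimately show ?thesis by blast
  qed
  ultimately have "(x, g x) \<notin> rel_interior ?S" using rel_interior_nonempty_interior by blast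
  moreover have "convex ?S" using assms by (simp add: convex_epigraph)
  moreover have "(x, g x) \<in> ?S" by (simp add: epigraph_def)
  ultimately obtain a where a: "a \<noteq> 0" "\<And>z. z \<in> ?S \<Longrightarrow> a \<bullet> (x, g x) \<le> a \<bullet> z"
    using supporting_hyperplane_rel_boundary by metis
  obtain v b where ab: "a = (v, b)" by fastforce
  have ineq: "v \<bullet> x + b * g x \<le> v \<bullet> z + b * s" if "g z \<le> s" for z s
    using a(2)[of "(z, s)"] that by (simp add: ab epigraph_def)
  have "b \<ge> 0" using ineq[of x "g x + 1"] by (simp add: algebra_simps)
  \<comment> \<open>For a vertical hyperplane, moving from \<open>x\<close> in direction
    \<open>- v\<close> stays over the domain and lowers the functional unless
    \<open>v = 0\<close>.\<close>
  moreover have "b \<noteq> 0"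
  proof
    assume b: "b = 0"
    then have "v \<bullet> x \<le> v \<bullet> (x - v)" using ineq[of "x - v" "g (x - v)"] by simp
    then have "v \<bullet> v \<le> 0" by (simp add: inner_diff_right)
    then have "v = 0" using inner_gt_zero_iff[of v] by (meson linorder_not_less)
    then show False using a(1) ab b by (simp add: zero_prod_def)
  qed
  ultimately have b: "b > 0" by simp
  have "- (1 / b) *\<^sub>R v \<in> subdiff g x"
    unfolding subdiff_def
  proof (intro CollectI allI)
    fix z
    have "v \<bullet> x + b * g x \<le> v \<bullet> z + b * g z" using ineq by simp
    then have "b * (g x - (1 / b) * (v \<bullet> (z - x))) \<le> b * g z"
      using b by (simp add: algebra_simps inner_diff_right)
    then show "g x + (- (1 / b) *\<^sub>R v) \<bullet> (z - x) \<le> g z" using b by simp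
  qed
  then show ?thesis by blast
qed

section \<open>Gradients and Frechet subgradients\<close>

lemma GDERIV_unique:
  fixes f :: "'a::real_inner \<Rightarrow> real"
  assumes "GDERIV f x :> d" "GDERIV f x :> e"
  shows "d = e"
proof -
  have "(\<lambda>u. u \<bullet> d) = (\<lambda>u. u \<bullet> e)"
    using assms has_derivative_unique unfolding gderiv_def by blast
  then show ?thesis by (metis vector_eq_ldot inner_commute)
qed

lemma GDERIV_grad:
  assumes "GDERIV (\<lambda>u. real_of_ereal (h u)) x :> d"
  shows "GDERIV (\<lambda>u. real_of_ereal (h u)) x :> grad h x"
  unfolding grad_def by (rule theI[of _ d]) (use assms GDERIV_unique in blast)+

text \<open>A division-free epsilon-delta form of the liminf condition, which also covers points
  where \<open>f\<close> is infinite. For a level \<open>c < 0\<close> the role of \<epsilon> is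
  played by \<open>- r\<close>, with \<open>r\<close> a real between \<open>c\<close> and 0.\<close>

lemma frechet_subdiffI:
  fixes f :: "'a::real_inner \<Rightarrow> ereal"
  assumes fin: "\<bar>f x\<bar> \<noteq> \<infinity>"
    and low: "\<And>\<epsilon>. \<epsilon> > 0 \<Longrightarrow> \<exists>\<delta>>0. \<forall>z. dist z x < \<delta> \<longrightarrow> f x + ereal (v \<bullet> (z - x) - \<epsilon> * norm (z - x)) \<le> f z"
  shows "v \<in> frechet_subdiff f x"
proof -
  obtain a where a: "f x = ereal a" using fin by (cases "f x") auto
  have "0 \<le> Liminf (at x) (\<lambda>z. (f z - f x - ereal (v \<bullet> (z - x))) / ereal (norm (z - x)))"
    unfolding le_Liminf_iff
  proof (intro allI impI)
    fix c :: ereal assume "c < 0"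
    then obtain r where r: "c < ereal r" "ereal r < 0" using ereal_dense2 by blast
    then obtain \<delta> where \<delta>: "\<delta> > 0"
      "\<And>z. dist z x < \<delta> \<Longrightarrow> f x + ereal (v \<bullet> (z - x) - (- r) * norm (z - x)) \<le> f z"
      using low[of "- r"] by auto
    have "c < (f z - f x - ereal (v \<bullet> (z - x))) / ereal (norm (z - x))" if z: "z \<noteq> x" "dist z x < \<delta>" for z
    proof -
      have n: "norm (z - x) > 0" using z by simp
      have "ereal r \<le> (f z - f x - ereal (v \<bullet> (z - x))) / ereal (norm (z - x))"
        using \<delta>(2)[OF z(2)] n by (cases "f z") (auto simp: a field_simps)
      then show ?thesis using r by (meson less_le_trans)
    qed
    then show "\<forall>\<^sub>F z in at x. c < (f z - f x - ereal (v \<bullet> (z - x))) / ereal (norm (z - x))"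
      unfolding eventually_at using \<delta>(1) by blast
  qed
  then show ?thesis using a by (auto simp: frechet_subdiff_def edom_def)
qed

lemma norm_add_scaleR_square:
  fixes e p :: "'a::real_inner"
  shows "(norm (e + a *\<^sub>R p))\<^sup>2 = (norm e)\<^sup>2 + 2 * a * (p \<bullet> e) + a\<^sup>2 * (p \<bullet> p)"
  unfolding power2_norm_eq_inner
  by (simp add: inner_add_left inner_add_right inner_commute power2_eq_square)

section \<open>Real values of \<open>eta\<close> and the Fenchel-Young inequality\<close>

definition etar :: "('a::real_inner \<Rightarrow> real) \<Rightarrow> 'a \<Rightarrow> 'a \<Rightarrow> real" where
  "etar g x y = x \<bullet> y - real_of_ereal (conjugate g y)"

lemma conjugate_upper: "ereal (x \<bullet> y - g x) \<le> conjugate g y"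
  unfolding conjugate_def by (rule SUP_upper) simp

lemma conjugate_eq_ereal:
  assumes "y \<in> edom (conjugate g)"
  shows "conjugate g y = ereal (real_of_ereal (conjugate g y))"
  using assms conjugate_upper[of 0 y g] by (cases "conjugate g y") (auto simp: edom_def)

lemma eta_eq_ereal:
  assumes "y \<in> edom (conjugate g)"
  shows "eta g x y = ereal (etar g x y)"
  unfolding eta_def etar_def by (subst conjugate_eq_ereal[OF assms]) simp

text \<open>Fenchel-Young at an arbitrary \<open>z\<close>. Taking \<open>z = x\<close> gives that
  \<open>etar\<close> is at most \<open>g\<close>; letting \<open>z\<close> vary produces the
  subgradient inequality when passing to limits.\<close>

lemma etar_le:
  assumes "y \<in> edom (conjugate g)"
  shows "etar g x y \<le> x \<bullet> y - z \<bullet> y + g z"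
proof -
  have "z \<bullet> y - g z \<le> real_of_ereal (conjugate g y)"
    using conjugate_upper[of z y g] conjugate_eq_ereal[OF assms] by (metis ereal_less_eq(3))
  then show ?thesis by (simp add: etar_def)
qed

lemma etar_le_self: "y \<in> edom (conjugate g) \<Longrightarrow> etar g x y \<le> g x"
  using etar_le[of y g x x] by simp

lemma etar_diff_left: "etar g x' y = etar g x y + (x' - x) \<bullet> y"
  by (simp add: etar_def inner_diff_left)

text \<open>Equality case of Fenchel-Young: the subgradient inequality says that \<open>x\<close>
  attains the supremum defining the conjugate.\<close>

lemma conjugate_subdiff:
  assumes "y \<in> subdiff g x"
  shows "conjugate g y = ereal (x \<bullet> y - g x)"
proof (rule antisym)
  show "conjugate g y \<le> ereal (x \<bullet> y - g x)"
    unfolding conjugate_def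
  proof (rule SUP_least)
    fix z
    have "g x + y \<bullet> (z - x) \<le> g z" using assms by (auto simp: subdiff_def)
    then show "ereal (z \<bullet> y - g z) \<le> ereal (x \<bullet> y - g x)"
      by (simp add: inner_diff_right inner_commute)
  qed
qed (rule conjugate_upper)

text \<open>The conjugate is a supremum of affine functions, hence convex, so
  \<open>etar g x\<close> is concave on the domain of the conjugate.\<close>

lemma etar_convex_comb:
  assumes "y \<in> edom (conjugate g)" "v \<in> edom (conjugate g)" "0 \<le> s" "s \<le> 1"
  defines "w \<equiv> (1 - s) *\<^sub>R y + s *\<^sub>R v"
  shows "w \<in> edom (conjugate g)" "(1 - s) * etar g x y + s * etar g x v \<le> etar g x w"
proof -
  let ?c = "\<lambda>y. real_of_ereal (conjugate g y)"
  have le: "conjugate g w \<le> ereal ((1 - s) * ?c y + s * ?c v)"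
    unfolding conjugate_def[of g w]
  proof (rule SUP_least)
    fix z
    have "z \<bullet> y - g z \<le> ?c y" "z \<bullet> v - g z \<le> ?c v"
      by (metis assms(1,2) conjugate_eq_ereal conjugate_upper ereal_less_eq(3))+
    then have "(1 - s) * (z \<bullet> y - g z) + s * (z \<bullet> v - g z) \<le> (1 - s) * ?c y + s * ?c v"
      using assms by (intro add_mono mult_left_mono) auto
    then show "ereal (z \<bullet> w - g z) \<le> ereal ((1 - s) * ?c y + s * ?c v)"
      by (simp add: w_def algebra_simps)
  qed
  then show w: "w \<in> edom (conjugate g)"
    unfolding edom_def by (auto intro: le_less_trans)
  have "?c w \<le> (1 - s) * ?c y + s * ?c v"
    using le conjugate_eq_ereal[OF w] by (metis ereal_less_eq(3))
  then show "(1 - s) * etar g x y + s * etar g x v \<le> etar g x w"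
    by (simp add: etar_def w_def algebra_simps)
qed

section \<open>Blocks\<close>

lemma subvec_in_coord_space [simp]: "subvec I x \<in> coord_space I"
  by (simp add: subvec_def coord_space_def)

lemma coord_space_diff: "a \<in> coord_space I \<Longrightarrow> b \<in> coord_space I \<Longrightarrow> a - b \<in> coord_space I"
  by (simp add: coord_space_def)

lemma inner_subvec: "d \<in> coord_space I \<Longrightarrow> subvec I a \<bullet> d = a \<bullet> d"
  unfolding inner_vec_def by (rule sum.cong) (auto simp: subvec_def coord_space_def)

lemma subvec_diff: "subvec I (a - b) = subvec I a - subvec I b"
  by (simp add: vec_eq_iff subvec_def)

lemma subvec_scaleR: "subvec I (c *\<^sub>R a) = c *\<^sub>R subvec I a"
  by (simp add: vec_eq_iff subvec_def)

lemma norm_subvec_le: "norm (subvec I x) \<le> norm x"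
  by (rule norm_le_componentwise_cart) (simp add: subvec_def)

lemma tendsto_subvec:
  assumes "(X \<longlongrightarrow> a) F"
  shows "((\<lambda>k. subvec I (X k)) \<longlongrightarrow> subvec I a) F"
  by (rule vec_tendstoI) (use tendsto_vec_nth[OF assms] in \<open>simp add: subvec_def\<close>)

lemma replace_block_diff: "z \<in> coord_space I \<Longrightarrow> replace_block I z x - x = z - subvec I x"
  by (simp add: vec_eq_iff subvec_def coord_space_def replace_block_def)

lemma subvec_replace_block: "z \<in> coord_space I \<Longrightarrow> subvec I (replace_block I z x) = z"
  by (simp add: vec_eq_iff subvec_def coord_space_def replace_block_def)

lemma subvec_replace_block_disjoint: "I \<inter> J = {} \<Longrightarrow> subvec J (replace_block I z x) = subvec J x"
  by (auto simp: vec_eq_iff subvec_def replace_block_def)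

lemma sum_subvec:
  assumes "coord_partition N B"
  shows "(\<Sum>j\<in>{1..N}. subvec (B j) a) = a"
proof (rule vec_eq_iff[THEN iffD2], rule allI)
  fix k
  have un: "(\<Union>j\<in>{1..N}. B j) = UNIV" and dis: "disjoint_family_on B {1..N}"
    using assms by (simp_all only: coord_partition_def)
  obtain j0 where j0: "j0 \<in> {1..N}" "k \<in> B j0" using un by (metis UN_E UNIV_I)
  have j0_iff: "k \<in> B j \<longleftrightarrow> j = j0" if "j \<in> {1..N}" for j
    using disjoint_family_onD[OF dis that j0(1)] j0(2) by blast
  have "(\<Sum>j\<in>{1..N}. subvec (B j) a $ k) = (\<Sum>j\<in>{1..N}. if j = j0 then a $ k else 0)"
    by (rule sum.cong) (simp_all only: subvec_def vec_lambda_beta j0_iff)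
  then show "(\<Sum>j\<in>{1..N}. subvec (B j) a) $ k = a $ k" using j0 by simp
qed

section \<open>The steps of the algorithm\<close>

locale fractional_program =
  fixes f h :: "real^'n \<Rightarrow> ereal" and g :: "real^'n \<Rightarrow> real"
    and N :: nat and B :: "nat \<Rightarrow> 'n set" and fb :: "nat \<Rightarrow> real^'n \<Rightarrow> ereal" and \<sigma> :: real
  assumes f_proper: "proper_on UNIV f"
    and h_proper: "proper_on UNIV h"
    and part: "coord_partition N B"
    and f_sum: "\<And>u. f u = (\<Sum>j\<in>{1..N}. fb j (subvec (B j) u))"
    and fb_proper: "\<And>j. j \<in> {1..N} \<Longrightarrow> proper_on (coord_space (B j)) (fb j)"
    and fb_lsc: "\<And>j. j \<in> {1..N} \<Longrightarrow> lsc_on (coord_space (B j)) (fb j)"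
    and f_cont: "continuous_on (edom f) f"
    and fb_bdd: "\<And>j. j \<in> {1..N} \<Longrightarrow> \<exists>c::real. \<forall>z\<in>coord_space (B j). ereal c \<le> fb j z"
    and h_diff: "loc_lipschitz_differentiable_on (Omega g) h"
    and g_convex: "convex_on UNIV g"
    and g_nonneg: "\<And>u. 0 \<le> g u"
    and zeta_nonneg: "\<And>u. u \<in> edom f \<Longrightarrow> 0 \<le> f u + h u"
    and \<sigma>_pos: "0 < \<sigma>"
begin

section \<open>Real-valued counterparts and feasible pairs\<close>

definition "fr x = real_of_ereal (f x)"
definition "hr x = real_of_ereal (h x)"
definition "fbr j z = real_of_ereal (fb j z)"
definition "Z x = fr x + hr x"
definition "D = edom f \<inter> Omega g"
text \<open>The pairs at which \<open>Qobj\<close> is a genuine quotient with positive denominator.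
  Membership of \<open>x\<close> in \<open>Omega g\<close> is left out because it follows from
  \<open>etar\<close> being at most \<open>g\<close>.\<close>

definition "feas x y \<longleftrightarrow> x \<in> edom f \<and> y \<in> edom (conjugate g) \<and> 0 < etar g x y"
definition "Qr x y = Z x / etar g x y"

lemma f_eq: "x \<in> edom f \<Longrightarrow> f x = ereal (fr x)"
  using f_proper by (cases "f x") (auto simp: fr_def proper_on_def edom_def)

lemma h_eq: "x \<in> Omega g \<Longrightarrow> h x = ereal (hr x)"
  using h_diff by (cases "h x") (auto simp: hr_def loc_lipschitz_differentiable_on_def)

lemma zeta_eq: "x \<in> D \<Longrightarrow> zeta f h x = ereal (Z x)"
  by (simp add: D_def zeta_def f_eq h_eq Z_def)

lemma Z_nonneg: "x \<in> D \<Longrightarrow> 0 \<le> Z x"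
  using zeta_nonneg[of x] zeta_eq[of x] by (auto simp: zeta_def D_def)

lemma g_pos: "x \<in> D \<Longrightarrow> 0 < g x"
  using g_nonneg[of x] by (auto simp: D_def Omega_def)

lemma Fobj_eq: "x \<in> D \<Longrightarrow> Fobj f g h x = ereal (Z x / g x)"
  using g_pos[of x] zeta_eq[of x] by (simp add: D_def Fobj_def)

lemma edom_Fobj: "edom (Fobj f g h) = D"
proof (intro set_eqI iffI)
  fix x assume "x \<in> edom (Fobj f g h)"
  then show "x \<in> D" by (auto simp: edom_def Fobj_def D_def split: if_splits)
qed (simp add: Fobj_eq edom_def)

lemma feas_D: "feas x y \<Longrightarrow> x \<in> D"
  using etar_le_self[of y g x] by (force simp: feas_def D_def Omega_def)

lemma Qobj_eq: "feas x y \<Longrightarrow> Qobj f g h x y = ereal (Qr x y)"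
  using zeta_eq[OF feas_D] by (auto simp: feas_def Qobj_def eta_eq_ereal Qr_def)

lemma Qr_nonneg: "feas x y \<Longrightarrow> 0 \<le> Qr x y"
  using Z_nonneg[OF feas_D] by (auto simp: Qr_def feas_def)

lemma Z_eq: "feas x y \<Longrightarrow> Z x = Qr x y * etar g x y"
  by (simp add: Qr_def feas_def)

text \<open>Both quotients have the same nonnegative numerator, and \<open>etar\<close> is at most
  \<open>g\<close>.\<close>

lemma F_le_Q: "feas x y \<Longrightarrow> Z x / g x \<le> Qr x y"
  unfolding Qr_def using Z_nonneg[OF feas_D] etar_le_self[of y g x]
  by (intro divide_left_mono mult_pos_pos) (auto simp: feas_def)

section \<open>Continuity and smoothness near a point\<close>

lemma open_Omega: "open (Omega g)"
  unfolding Omega_def using convex_on_continuous[OF open_UNIV g_convex]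
  by (intro open_Collect_neq) auto

lemma g_cont: "continuous_on S g"
  using convex_on_continuous[OF open_UNIV g_convex] continuous_on_subset by blast

lemma g_tendsto: "(X \<longlongrightarrow> a) F \<Longrightarrow> ((\<lambda>k. g (X k)) \<longlongrightarrow> g a) F"
  by (rule continuous_on_tendsto_compose[OF g_cont[of UNIV]]) auto

lemma hr_GDERIV: "x \<in> Omega g \<Longrightarrow> GDERIV hr x :> grad h x"
  using h_diff GDERIV_grad[of h x] unfolding loc_lipschitz_differentiable_on_def hr_def[abs_def]
  by blast

text \<open>Since \<open>Omega g\<close> is open, the given neighbourhood can be shrunk to a ball
  inside it. The ball is convex, which the descent inequality needs, and the absolute value of the
  constant makes it nonnegative.\<close>

lemma grad_lipschitz_near:
  assumes "x \<in> Omega g"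
  obtains \<rho> L where "\<rho> > 0" "L \<ge> 0" "ball x \<rho> \<subseteq> Omega g"
    "\<And>u v. u \<in> ball x \<rho> \<Longrightarrow> v \<in> ball x \<rho> \<Longrightarrow> norm (grad h u - grad h v) \<le> L * norm (u - v)"
proof -
  obtain U L where U: "open U" "x \<in> U"
    "\<forall>u\<in>U \<inter> Omega g. \<forall>v\<in>U \<inter> Omega g. norm (grad h u - grad h v) \<le> L * norm (u - v)"
    using h_diff assms unfolding loc_lipschitz_differentiable_on_def by metis
  then obtain \<rho> where \<rho>: "\<rho> > 0" "ball x \<rho> \<subseteq> U \<inter> Omega g"
    using assms open_Omega by (metis IntI open_Int openE)
  show ?thesis
  proof (rule that[of \<rho> "\<bar>L\<bar>"])
    fix u v assume "u \<in> ball x \<rho>" "v \<in> ball x \<rho>"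
    then have "norm (grad h u - grad h v) \<le> L * norm (u - v)" using U \<rho> by blast
    also have "\<dots> \<le> \<bar>L\<bar> * norm (u - v)" by (intro mult_right_mono) auto
    finally show "norm (grad h u - grad h v) \<le> \<bar>L\<bar> * norm (u - v)" .
  qed (use \<rho> in auto)
qed

lemma grad_tendsto:
  assumes "xs \<in> Omega g" "(X \<longlongrightarrow> xs) F"
  shows "((\<lambda>k. grad h (X k)) \<longlongrightarrow> grad h xs) F"
proof -
  obtain \<rho> L where \<rho>: "\<rho> > 0"
    "\<And>u v. u \<in> ball xs \<rho> \<Longrightarrow> v \<in> ball xs \<rho> \<Longrightarrow> norm (grad h u - grad h v) \<le> L * norm (u - v)"
    using grad_lipschitz_near[OF assms(1)] by metis
  have "\<forall>\<^sub>F k in F. X k \<in> ball xs \<rho>"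
    using assms(2) \<rho>(1) by (intro topological_tendstoD) auto
  then have ev: "\<forall>\<^sub>F k in F. norm (grad h (X k) - grad h xs) \<le> L * norm (X k - xs)"
    by eventually_elim (use \<rho> in auto)
  have "((\<lambda>k. X k - xs) \<longlongrightarrow> 0) F" using assms(2) by (simp add: LIM_zero)
  then have "((\<lambda>k. norm (X k - xs)) \<longlongrightarrow> 0) F" by (simp add: tendsto_norm_zero)
  then have "((\<lambda>k. L * norm (X k - xs)) \<longlongrightarrow> 0) F" by (rule tendsto_mult_right_zero)
  then have "((\<lambda>k. grad h (X k) - grad h xs) \<longlongrightarrow> 0) F"
    by (rule Lim_null_comparison[OF ev])
  then show ?thesis by (simp add: LIM_zero_iff)
qed

text \<open>Mean value theorem along the segment combined with the Lipschitz bound. The constant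
  \<open>L\<close> instead of the sharp \<open>L / 2\<close> only makes the admissible step sizes
  smaller.\<close>

lemma descent:
  assumes "convex S" "S \<subseteq> Omega g" "x \<in> S" "x' \<in> S"
    and L: "\<And>u v. u \<in> S \<Longrightarrow> v \<in> S \<Longrightarrow> norm (grad h u - grad h v) \<le> L * norm (u - v)" "L \<ge> 0"
  shows "hr x' \<le> hr x + grad h x \<bullet> (x' - x) + L * (norm (x' - x))\<^sup>2"
proof -
  define d where "d = x' - x"
  have in_S: "x + t *\<^sub>R d \<in> S" if "t \<in> {0..1}" for t
  proof -
    have "x + t *\<^sub>R d = (1 - t) *\<^sub>R x + t *\<^sub>R x'" by (simp add: d_def algebra_simps)
    then show ?thesis using assms that by (auto intro: convexD)
  qed
  have "\<exists>t\<in>{0<..<1}. hr (x + 1 *\<^sub>R d) - hr (x + 0 *\<^sub>R d) = (1 - 0) *\<^sub>R d \<bullet> grad h (x + t *\<^sub>R d)"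
  proof (rule mvt_simple)
    fix t :: real assume t: "0 \<le> t" "t \<le> 1"
    have 1: "((\<lambda>t. x + t *\<^sub>R d) has_derivative (\<lambda>u. u *\<^sub>R d)) (at t within {0..1})"
      by (auto intro!: derivative_eq_intros)
    have "(hr has_derivative (\<lambda>u. u \<bullet> grad h (x + t *\<^sub>R d))) (at (x + t *\<^sub>R d))"
      using hr_GDERIV[of "x + t *\<^sub>R d"] in_S[of t] t assms(2) unfolding gderiv_def by auto
    from has_derivative_compose[OF 1 this]
    show "((\<lambda>t. hr (x + t *\<^sub>R d)) has_derivative (\<lambda>u. u *\<^sub>R d \<bullet> grad h (x + t *\<^sub>R d))) (at t within {0..1})" .
  qed simp
  then obtain t where t: "t \<in> {0<..<1}" "hr x' - hr x = grad h (x + t *\<^sub>R d) \<bullet> d"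
    by (auto simp: d_def inner_commute)
  have "(grad h (x + t *\<^sub>R d) - grad h x) \<bullet> d \<le> norm (grad h (x + t *\<^sub>R d) - grad h x) * norm d"
    by (rule norm_cauchy_schwarz)
  also have "\<dots> \<le> (L * norm (t *\<^sub>R d)) * norm d"
    using L(1)[OF in_S[of t] assms(3)] t by (intro mult_right_mono) auto
  also have "\<dots> = (L * (norm d)\<^sup>2) * t" using t by (simp add: power2_eq_square)
  also have "\<dots> \<le> L * (norm d)\<^sup>2" using t L(2) by (intro mult_right_le_one_le) auto
  finally show ?thesis using t(2) by (simp add: d_def inner_diff_left)
qed

text \<open>Continuity of \<open>f\<close> is relative to its domain, hence the requirement that the
  sequence eventually lies there.\<close>

lemma fr_tendsto:
  assumes "xs \<in> edom f" "(X \<longlongrightarrow> xs) F" "\<forall>\<^sub>F k in F. X k \<in> edom f"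
  shows "((\<lambda>k. fr (X k)) \<longlongrightarrow> fr xs) F"
proof -
  have "((\<lambda>k. f (X k)) \<longlongrightarrow> ereal (fr xs)) F"
    using continuous_on_tendsto_compose[OF f_cont assms(2,1,3)] assms(1) by (simp add: f_eq)
  then show ?thesis unfolding fr_def[of "X _"] by (rule lim_real_of_ereal)
qed

lemma Z_tendsto:
  assumes "xs \<in> D" "(X \<longlongrightarrow> xs) F" "\<forall>\<^sub>F k in F. X k \<in> D"
  shows "((\<lambda>k. Z (X k)) \<longlongrightarrow> Z xs) F"
proof -
  have "isCont hr xs"
    using hr_GDERIV[of xs] assms(1) has_derivative_continuous unfolding gderiv_def D_def by blast
  then have "((\<lambda>k. hr (X k)) \<longlongrightarrow> hr xs) F" using assms(2) by (rule isCont_tendsto_compose)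
  moreover have "((\<lambda>k. fr (X k)) \<longlongrightarrow> fr xs) F"
    using assms by (intro fr_tendsto) (auto simp: D_def elim: eventually_mono)
  ultimately show ?thesis unfolding Z_def by (intro tendsto_intros)
qed

section \<open>Block structure of \<open>f\<close>\<close>

lemma fb_not_MInf: "j \<in> {1..N} \<Longrightarrow> z \<in> coord_space (B j) \<Longrightarrow> fb j z \<noteq> -\<infinity>"
  using fb_proper by (auto simp: proper_on_def)

lemma fb_eq: "j \<in> {1..N} \<Longrightarrow> z \<in> coord_space (B j) \<Longrightarrow> fb j z \<noteq> \<infinity> \<Longrightarrow> fb j z = ereal (fbr j z)"
  using fb_not_MInf[of j z] by (cases "fb j z") (auto simp: fbr_def)

lemma fb_fin: "x \<in> edom f \<Longrightarrow> j \<in> {1..N} \<Longrightarrow> fb j (subvec (B j) x) \<noteq> \<infinity>"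
  using f_sum[of x] sum_Pinfty[of "\<lambda>j. fb j (subvec (B j) x)" "{1..N}"] by (auto simp: edom_def)

lemma fr_sum: "x \<in> edom f \<Longrightarrow> fr x = (\<Sum>j\<in>{1..N}. fbr j (subvec (B j) x))"
proof -
  assume x: "x \<in> edom f"
  have "f x = (\<Sum>j\<in>{1..N}. ereal (fbr j (subvec (B j) x)))"
    unfolding f_sum using fb_eq fb_fin[OF x] by (intro sum.cong) auto
  then show ?thesis by (simp add: fr_def)
qed

text \<open>Disjointness of the blocks leaves all summands other than the \<open>j\<close>-th
  unchanged.\<close>

lemma replace_block_fr:
  assumes j: "j \<in> {1..N}" and x: "x \<in> edom f" and z: "z \<in> coord_space (B j)" "fb j z \<noteq> \<infinity>"
  shows "replace_block (B j) z x \<in> edom f"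
    and "fr (replace_block (B j) z x) = fr x + fbr j z - fbr j (subvec (B j) x)"
proof -
  let ?x = "replace_block (B j) z x"
  have other: "subvec (B k) ?x = subvec (B k) x" if "k \<in> {1..N}" "k \<noteq> j" for k
    using that j part
    by (intro subvec_replace_block_disjoint) (auto simp: coord_partition_def disjoint_family_on_def)
  have same: "subvec (B j) ?x = z" using z by (simp add: subvec_replace_block)
  have "fb k (subvec (B k) ?x) \<noteq> \<infinity>" if "k \<in> {1..N}" for k
    using that other[OF that] same z fb_fin[OF x that] by (cases "k = j") auto
  then have "f ?x \<noteq> \<infinity>" unfolding f_sum by (simp add: sum_Pinfty)
  then show x': "?x \<in> edom f" by (simp add: edom_def)
  have "fr ?x = fbr j z + (\<Sum>k\<in>{1..N} - {j}. fbr k (subvec (B k) x))"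
    unfolding fr_sum[OF x'] using j other by (subst sum.remove[of _ j]) (auto simp: same)
  moreover have "fr x = fbr j (subvec (B j) x) + (\<Sum>k\<in>{1..N} - {j}. fbr k (subvec (B k) x))"
    unfolding fr_sum[OF x] using j by (subst sum.remove[of _ j]) auto
  ultimately show "fr ?x = fr x + fbr j z - fbr j (subvec (B j) x)" by simp
qed

section \<open>Y-steps and accepted points\<close>

text \<open>Up to a positive factor and a constant, the proximal objective is the negative of
  \<open>etar g x w\<close> minus a quadratic penalty for leaving \<open>y\<close>. A Y-step is thus
  proximal ascent of \<open>etar\<close> in its second argument.\<close>

lemma step_Y_props:
  assumes st: "step_Y g \<alpha> (x, y) (x', y')" and y: "y \<in> edom (conjugate g)" and \<alpha>: "0 < \<alpha>"
  shows "x' = x" "y' \<in> edom (conjugate g)"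
    and "\<And>w. w \<in> edom (conjugate g) \<Longrightarrow>
      etar g x w - (norm (w - y))\<^sup>2 / (2 * \<alpha>) \<le> etar g x y' - (norm (y' - y))\<^sup>2 / (2 * \<alpha>)"
proof -
  let ?u = "y + \<alpha> *\<^sub>R x" and ?c = "\<lambda>w. real_of_ereal (conjugate g w)"
  let ?\<phi> = "\<lambda>w. ereal \<alpha> * conjugate g w + ereal (1/2 * (norm (w - ?u))\<^sup>2)"
  show "x' = x" using st by (simp add: step_Y_def)
  have min: "\<not> ?\<phi> w < ?\<phi> y'" for w
    using st by (auto simp: step_Y_def prox_on_def is_arg_min_def)
  have fin: "?\<phi> w = ereal (\<alpha> * ?c w + 1/2 * (norm (w - ?u))\<^sup>2)" if "w \<in> edom (conjugate g)" for w
    by (subst conjugate_eq_ereal[OF that]) simp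
  show y': "y' \<in> edom (conjugate g)"
  proof (rule ccontr)
    assume "y' \<notin> edom (conjugate g)"
    then have "conjugate g y' = \<infinity>" by (simp add: edom_def)
    then show False using min[of y] \<alpha> unfolding fin[OF y] by simp
  qed
  fix w assume w: "w \<in> edom (conjugate g)"
  \<comment> \<open>Completing the square; the final bracket does not depend on \<open>w\<close> and
    cancels in the comparison.\<close>
  have sq: "1/2 * (norm (w - ?u))\<^sup>2 = (norm (w - y))\<^sup>2 / 2 - \<alpha> * (x \<bullet> w) + (\<alpha> * (x \<bullet> y) + \<alpha>\<^sup>2 * (x \<bullet> x) / 2)" for w
  proof -
    have "w - ?u = (w - y) + (- \<alpha>) *\<^sub>R x" by simp
    then show ?thesis
      using norm_add_scaleR_square[of "w - y" "- \<alpha>" x] by (simp add: inner_diff_right algebra_simps)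
  qed
  have "\<alpha> * ?c y' + 1/2 * (norm (y' - ?u))\<^sup>2 \<le> \<alpha> * ?c w + 1/2 * (norm (w - ?u))\<^sup>2"
    using min[of w] fin[OF w] fin[OF y'] by simp
  then have "\<alpha> * (etar g x w - (norm (w - y))\<^sup>2 / (2 * \<alpha>)) \<le> \<alpha> * (etar g x y' - (norm (y' - y))\<^sup>2 / (2 * \<alpha>))"
    unfolding sq using \<alpha> by (simp add: etar_def algebra_simps)
  then show "etar g x w - (norm (w - y))\<^sup>2 / (2 * \<alpha>) \<le> etar g x y' - (norm (y' - y))\<^sup>2 / (2 * \<alpha>)"
    using \<alpha> by simp
qed

text \<open>Acceptance alone restores feasibility: a nonpositive \<open>etar\<close> would make the
  right side of the test nonpositive, forcing \<open>x' = x\<close>, where \<open>etar\<close> is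
  positive.\<close>

lemma accepts_feas:
  assumes xy: "feas x y" and q: "0 \<le> q" and acc: "accepts f g h \<sigma> (ereal q) x y x'"
  shows "feas x' y" "Z x' + \<sigma> / 2 * (norm (x' - x))\<^sup>2 \<le> q * etar g x' y"
proof -
  have y: "y \<in> edom (conjugate g)" using xy by (simp add: feas_def)
  have le: "f x' + h x' + ereal (\<sigma> / 2 * (norm (x' - x))\<^sup>2) \<le> ereal (q * etar g x' y)"
    using acc by (simp add: accepts_def eta_eq_ereal[OF y] zeta_def)
  \<comment> \<open>The point \<open>x'\<close> is not yet known to lie in \<open>Omega g\<close>,
    so finiteness of \<open>h\<close> must come from the test itself: neither summand is minus
    infinity and the sum is bounded by a real number.\<close>
  have "f x' \<noteq> -\<infinity>" "h x' \<noteq> -\<infinity>" using f_proper h_proper by (auto simp: proper_on_def)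
  with le have fin: "f x' < \<infinity>" "h x' < \<infinity>" by (cases "f x'"; cases "h x'"; simp)+
  then have x'f: "x' \<in> edom f" by (simp add: edom_def)
  have "h x' = ereal (hr x')" using fin \<open>h x' \<noteq> -\<infinity>\<close> by (cases "h x'") (auto simp: hr_def)
  then have le': "Z x' + \<sigma> / 2 * (norm (x' - x))\<^sup>2 \<le> q * etar g x' y" and nn: "0 \<le> Z x'"
    using le zeta_nonneg[OF x'f] by (simp_all add: f_eq[OF x'f] Z_def)
  have "0 < etar g x' y"
  proof (rule ccontr)
    assume "\<not> 0 < etar g x' y"
    then have "q * etar g x' y \<le> 0" using q by (simp add: mult_nonneg_nonpos)
    then have "\<sigma> / 2 * (norm (x' - x))\<^sup>2 \<le> 0" using le' nn by linarith
    then have "x' = x" using \<sigma>_pos by (simp add: mult_le_0_iff)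
    then show False using xy \<open>\<not> 0 < etar g x' y\<close> by (simp add: feas_def)
  qed
  then show "feas x' y" using x'f y by (simp add: feas_def)
  show "Z x' + \<sigma> / 2 * (norm (x' - x))\<^sup>2 \<le> q * etar g x' y" by (rule le')
qed

section \<open>Block proximal steps and the line search\<close>

definition "prox_step j a q x y = prox_on (coord_space (B j)) (\<lambda>w. ereal a * fb j w)
  (subvec (B j) x - a *\<^sub>R subvec (B j) (grad h x) + (a * q) *\<^sub>R subvec (B j) y)"

text \<open>Expanding the square shows that the block step minimises \<open>fb j\<close> plus the
  linearisation of \<open>h\<close> minus \<open>q\<close> times \<open>y\<close>, with penalty
  weight \<open>1 / (2 * a)\<close>. Full vectors may stand in the inner products because the
  displacements vanish off the block.\<close>

lemma prox_step_ineq: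
  assumes j: "j \<in> {1..N}" and x: "x \<in> edom f" and a: "0 < a"
    and z: "z \<in> prox_step j a q x y"
  shows "z \<in> coord_space (B j)" "fb j z \<noteq> \<infinity>"
    and "\<And>w. w \<in> coord_space (B j) \<Longrightarrow> fb j w \<noteq> \<infinity> \<Longrightarrow>
      fbr j z + (grad h x - q *\<^sub>R y) \<bullet> (z - subvec (B j) x) + (norm (z - subvec (B j) x))\<^sup>2 / (2 * a)
      \<le> fbr j w + (grad h x - q *\<^sub>R y) \<bullet> (w - subvec (B j) x) + (norm (w - subvec (B j) x))\<^sup>2 / (2 * a)"
proof -
  define s where "s = subvec (B j) x"
  define v where "v = grad h x - q *\<^sub>R y"
  let ?u = "s - a *\<^sub>R subvec (B j) v"
  let ?\<phi> = "\<lambda>w. ereal a * fb j w + ereal (1/2 * (norm (w - ?u))\<^sup>2)"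
  have s: "s \<in> coord_space (B j)" by (simp add: s_def)
  have u: "subvec (B j) x - a *\<^sub>R subvec (B j) (grad h x) + (a * q) *\<^sub>R subvec (B j) y = ?u"
    by (simp add: s_def v_def subvec_diff subvec_scaleR algebra_simps)
  have zc: "z \<in> coord_space (B j)" and min: "\<And>w. w \<in> coord_space (B j) \<Longrightarrow> \<not> ?\<phi> w < ?\<phi> z"
    using z unfolding prox_step_def u by (auto simp: prox_on_def is_arg_min_def)
  show "z \<in> coord_space (B j)" by (rule zc)
  have fin: "?\<phi> w = ereal (a * fbr j w + 1/2 * (norm (w - ?u))\<^sup>2)"
    if "w \<in> coord_space (B j)" "fb j w \<noteq> \<infinity>" for w
    using fb_eq[OF j that] by simp
  have fs: "fb j s \<noteq> \<infinity>" using fb_fin[OF x j] by (simp add: s_def)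
  show zf: "fb j z \<noteq> \<infinity>"
  proof
    assume "fb j z = \<infinity>"
    then show False using min[OF s] a unfolding fin[OF s fs] by simp
  qed
  have sq: "1/2 * (norm (w - ?u))\<^sup>2 = (norm (w - s))\<^sup>2 / 2 + a * (v \<bullet> (w - s))
      + a\<^sup>2 * (subvec (B j) v \<bullet> subvec (B j) v) / 2"
    if "w \<in> coord_space (B j)" for w
  proof -
    have "v \<bullet> (w - s) = subvec (B j) v \<bullet> (w - s)"
      using inner_subvec[OF coord_space_diff[OF that s]] by simp
    moreover have eq: "w - ?u = (w - s) + a *\<^sub>R subvec (B j) v" by simp
    ultimately show ?thesis unfolding eq norm_add_scaleR_square by simp
  qed
  fix w assume w: "w \<in> coord_space (B j)" "fb j w \<noteq> \<infinity>"
  have "a * fbr j z + 1/2 * (norm (z - ?u))\<^sup>2 \<le> a * fbr j w + 1/2 * (norm (w - ?u))\<^sup>2"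
    using min[OF w(1)] fin[OF w] fin[OF zc zf] by simp
  then have "a * (fbr j z + v \<bullet> (z - s) + (norm (z - s))\<^sup>2 / (2 * a))
      \<le> a * (fbr j w + v \<bullet> (w - s) + (norm (w - s))\<^sup>2 / (2 * a))"
    unfolding sq[OF w(1)] sq[OF zc] using a by (simp add: algebra_simps)
  then show "fbr j z + (grad h x - q *\<^sub>R y) \<bullet> (z - subvec (B j) x) + (norm (z - subvec (B j) x))\<^sup>2 / (2 * a)
      \<le> fbr j w + (grad h x - q *\<^sub>R y) \<bullet> (w - subvec (B j) x) + (norm (w - subvec (B j) x))\<^sup>2 / (2 * a)"
    using a by (simp add: v_def s_def)
qed

text \<open>Near \<open>xs\<close> the sum \<open>f\<close> is bounded above on its domain by
  relative continuity; subtracting the lower bounds of the other blocks isolates block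
  \<open>j\<close>.\<close>

lemma fbr_upper_near:
  assumes j: "j \<in> {1..N}" and xs: "xs \<in> edom f"
  obtains C \<rho> where "\<rho> > 0" "\<And>x. x \<in> edom f \<Longrightarrow> dist x xs < \<rho> \<Longrightarrow> fbr j (subvec (B j) x) \<le> C"
proof -
  have "(fr \<longlongrightarrow> fr xs) (at xs within edom f)"
    by (rule fr_tendsto[OF xs]) (auto simp: eventually_at_filter)
  then have "\<forall>\<^sub>F x in at xs within edom f. fr x < fr xs + 1"
    by (rule order_tendstoD) simp
  then obtain \<rho> where \<rho>: "\<rho> > 0"
      "\<And>x. x \<in> edom f \<Longrightarrow> x \<noteq> xs \<Longrightarrow> dist x xs < \<rho> \<Longrightarrow> fr x < fr xs + 1"
    unfolding eventually_at by blast
  obtain c :: "nat \<Rightarrow> real" where c: "\<And>k z. k \<in> {1..N} \<Longrightarrow> z \<in> coord_space (B k) \<Longrightarrow> ereal (c k) \<le> fb k z"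
    using fb_bdd by metis
  show ?thesis
  proof (rule that[OF \<rho>(1)])
    fix x assume x: "x \<in> edom f" "dist x xs < \<rho>"
    have "c k \<le> fbr k (subvec (B k) x)" if "k \<in> {1..N}" for k
      using c[OF that, of "subvec (B k) x"] fb_eq[OF that _ fb_fin[OF x(1) that]] by simp
    then have "(\<Sum>k\<in>{1..N} - {j}. c k) \<le> (\<Sum>k\<in>{1..N} - {j}. fbr k (subvec (B k) x))"
      by (intro sum_mono) auto
    moreover have "fr x = fbr j (subvec (B j) x) + (\<Sum>k\<in>{1..N} - {j}. fbr k (subvec (B k) x))"
      unfolding fr_sum[OF x(1)] using j by (subst sum.remove[of _ j]) auto
    moreover have "fr x \<le> fr xs + 1" using \<rho>(2)[of x] x by (cases "x = xs") auto
    ultimately show "fbr j (subvec (B j) x) \<le> fr xs + 1 - (\<Sum>k\<in>{1..N} - {j}. c k)" by linarith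
  qed
qed

text \<open>For small step sizes the trial point stays where \<open>\<nabla>h\<close> is Lipschitz, because the block
  functions are bounded below and \<open>f\<close> is bounded near \<open>xs\<close>; there the usual sufficient-decrease
  argument applies.\<close>

lemma line_search_accepts_near:
  assumes j: "j \<in> {1..N}" and xs: "xs \<in> D" and Qb: "0 \<le> Qb" and Yb: "0 \<le> Yb"
  obtains \<rho> a where "0 < \<rho>" "0 < a"
    "\<And>x y \<alpha> z q. dist x xs < \<rho> \<Longrightarrow> norm y \<le> Yb \<Longrightarrow> feas x y \<Longrightarrow> Qr x y \<le> Qb \<Longrightarrow> Qr x y \<le> q \<Longrightarrow>
      0 < \<alpha> \<Longrightarrow> \<alpha> \<le> a \<Longrightarrow>
      z \<in> prox_step j \<alpha> (Qr x y) x y \<Longrightarrow>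
      accepts f g h \<sigma> (ereal q) x y (replace_block (B j) z x)"
proof -
  have xsD: "xs \<in> edom f" "xs \<in> Omega g" using xs by (auto simp: D_def)
  obtain \<rho>1 L where \<rho>1: "\<rho>1 > 0" "L \<ge> 0" "ball xs \<rho>1 \<subseteq> Omega g"
    "\<And>u v. u \<in> ball xs \<rho>1 \<Longrightarrow> v \<in> ball xs \<rho>1 \<Longrightarrow> norm (grad h u - grad h v) \<le> L * norm (u - v)"
    using grad_lipschitz_near[OF xsD(2)] by metis
  obtain C \<rho>2 where \<rho>2: "\<rho>2 > 0"
    "\<And>x. x \<in> edom f \<Longrightarrow> dist x xs < \<rho>2 \<Longrightarrow> fbr j (subvec (B j) x) \<le> C"
    using fbr_upper_near[OF j xsD(1)] by metis
  obtain c where c: "\<And>z. z \<in> coord_space (B j) \<Longrightarrow> ereal c \<le> fb j z"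
    using fb_bdd[OF j] by blast
  define \<rho> where "\<rho> = min (\<rho>1 / 2) \<rho>2"
  \<comment> \<open>\<open>V\<close> bounds the linear coefficient
    \<open>grad h x - Qr x y *\<^sub>R y\<close> near \<open>xs\<close>. A step of length at least
    \<rho> would satisfy \<open>norm d \<le> 2 * \<alpha> * K\<close>. The two bounds in
    \<open>a\<close> make this less than \<rho> and give
    \<open>L + \<sigma> / 2 \<le> 1 / (2 * \<alpha>)\<close>; the 1 added to \<open>K\<close> avoids
    a zero denominator.\<close>
  define V where "V = norm (grad h xs) + L * \<rho> + Qb * Yb"
  define K where "K = \<bar>C - c\<bar> / \<rho> + V"
  define a where "a = min (1 / (2 * L + \<sigma>)) (\<rho> / (2 * (K + 1)))"
  have \<rho>: "\<rho> > 0" "\<rho> \<le> \<rho>1 / 2" "\<rho> \<le> \<rho>2" using \<rho>1 \<rho>2 by (auto simp: \<rho>_def)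
  have V: "V \<ge> 0" using \<rho> \<rho>1 Qb Yb by (simp add: V_def)
  have K: "K \<ge> 0" using V \<rho> by (simp add: K_def)
  have a: "a > 0" using K \<rho> \<rho>1 \<sigma>_pos by (simp add: a_def)
  show ?thesis
  proof (rule that[OF \<rho>(1) a])
    fix x y \<alpha> z q
    assume x: "dist x xs < \<rho>" and y: "norm y \<le> Yb" and xy: "feas x y" and Q: "Qr x y \<le> Qb" "Qr x y \<le> q"
      and \<alpha>: "0 < \<alpha>" "\<alpha> \<le> a"
      and z: "z \<in> prox_step j \<alpha> (Qr x y) x y"
    define x' where "x' = replace_block (B j) z x"
    define d where "d = x' - x"
    define v where "v = grad h x - Qr x y *\<^sub>R y"
    have xf: "x \<in> edom f" and yc: "y \<in> edom (conjugate g)" using xy by (auto simp: feas_def)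
    note pz = prox_step_ineq[OF j xf \<alpha>(1) z]
    have d: "d = z - subvec (B j) x" using replace_block_diff[OF pz(1)] by (simp add: d_def x'_def)
    have ineq: "fbr j z + v \<bullet> d + (norm d)\<^sup>2 / (2 * \<alpha>) \<le> fbr j (subvec (B j) x)"
      using pz(3)[OF subvec_in_coord_space fb_fin[OF xf j]] by (simp add: d v_def)
    have "norm (grad h x) \<le> norm (grad h xs) + L * \<rho>"
    proof -
      have "norm (grad h x - grad h xs) \<le> L * norm (x - xs)"
        using \<rho>1(1) \<rho> x by (intro \<rho>1(4)) (auto simp: dist_commute)
      also have "\<dots> \<le> L * \<rho>" using x \<rho>1(2) by (intro mult_left_mono) (auto simp: dist_norm)
      finally show ?thesis using norm_triangle_ineq2[of "grad h x" "grad h xs"] by linarith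
    qed
    moreover have "norm (Qr x y *\<^sub>R y) \<le> Qb * Yb"
      using Q y Qr_nonneg[OF xy] by (auto intro!: mult_mono)
    ultimately have v: "norm v \<le> V"
      unfolding v_def V_def using norm_triangle_ineq4[of "grad h x" "Qr x y *\<^sub>R y"] by linarith
    \<comment> \<open>If the step had length at least \<rho>, the constant gap \<open>C - c\<close>
      could be absorbed into a multiple of \<open>norm d\<close>, leaving a quadratic bounded by a
      linear term.\<close>
    have "norm d < \<rho>"
    proof (rule ccontr)
      assume "\<not> norm d < \<rho>"
      then have nd: "norm d \<ge> \<rho>" by simp
      have "c \<le> fbr j z" using c[OF pz(1)] fb_eq[OF j pz(1,2)] by simp
      moreover have "fbr j (subvec (B j) x) \<le> C" using \<rho>2(2)[OF xf] x \<rho> by simp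
      moreover have "- (v \<bullet> d) \<le> V * norm d"
        using norm_cauchy_schwarz[of "- v" d] mult_right_mono[OF v, of "norm d"] by simp
      ultimately have "(norm d)\<^sup>2 / (2 * \<alpha>) \<le> \<bar>C - c\<bar> + V * norm d" using ineq by linarith
      also have "\<bar>C - c\<bar> \<le> \<bar>C - c\<bar> / \<rho> * norm d"
        using nd \<rho> mult_left_mono[OF nd, of "\<bar>C - c\<bar> / \<rho>"] by simp
      finally have "(norm d)\<^sup>2 / (2 * \<alpha>) \<le> K * norm d" by (simp add: K_def algebra_simps)
      then have "norm d * norm d \<le> (2 * \<alpha> * K) * norm d"
        using \<alpha> by (simp add: divide_le_eq power2_eq_square algebra_simps)
      then have "norm d \<le> 2 * \<alpha> * K" using nd \<rho> mult_right_le_imp_le[of "norm d" "norm d" "2 * \<alpha> * K"] by linarith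
      also have "\<dots> \<le> 2 * (\<rho> / (2 * (K + 1))) * K"
        using \<alpha>(2) K by (intro mult_right_mono mult_left_mono) (auto simp: a_def)
      also have "\<dots> < \<rho>" using K \<rho> by (simp add: field_simps)
      finally show False using nd by simp
    qed
    then have x'b: "x' \<in> ball xs \<rho>1"
      using dist_triangle[of xs x' x] x \<rho> by (simp add: d_def dist_norm norm_minus_commute)
    have xb: "x \<in> ball xs \<rho>1" using x \<rho> \<rho>1(1) by (simp add: dist_commute)
    have hr: "hr x' \<le> hr x + grad h x \<bullet> d + L * (norm d)\<^sup>2"
      unfolding d_def using \<rho>1 xb x'b by (intro descent[of "ball xs \<rho>1"]) auto
    note rb = replace_block_fr[OF j xf pz(1,2), folded x'_def]
    have x'D: "x' \<in> D" using rb(1) x'b \<rho>1(3) by (auto simp: D_def)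
    define qq where "qq = Qr x y"
    have "\<alpha> \<le> 1 / (2 * L + \<sigma>)" using \<alpha>(2) by (simp add: a_def)
    then have "L + \<sigma> / 2 \<le> 1 / (2 * \<alpha>)" using \<alpha>(1) \<rho>1(2) \<sigma>_pos by (simp add: field_simps)
    then have "(L + \<sigma> / 2) * (norm d)\<^sup>2 \<le> 1 / (2 * \<alpha>) * (norm d)\<^sup>2" by (rule mult_right_mono) simp
    then have "Z x' \<le> Z x + qq * (y \<bullet> d) - \<sigma> / 2 * (norm d)\<^sup>2"
      using hr ineq rb(2) by (simp add: Z_def v_def qq_def inner_diff_left algebra_simps)
    also have "Z x = qq * etar g x y" using Z_eq[OF xy] by (simp add: qq_def)
    finally have key: "Z x' + \<sigma> / 2 * (norm d)\<^sup>2 \<le> qq * etar g x' y"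
      by (simp add: etar_diff_left[of g x' y x] d_def inner_commute algebra_simps)
    have qq: "0 \<le> qq" using Qr_nonneg[OF xy] by (simp add: qq_def)
    have nn: "0 \<le> \<sigma> / 2 * (norm d)\<^sup>2" using \<sigma>_pos by simp
    \<comment> \<open>Replacing \<open>qq\<close> by the larger reference value \<open>q\<close>
      needs this sign. The inequality \<open>key\<close> reveals it only when \<open>qq\<close> is
      positive; for \<open>qq = 0\<close> it forces \<open>d = 0\<close>.\<close>
    have "0 \<le> etar g x' y"
    proof (cases "qq = 0")
      case True
      then have "\<sigma> / 2 * (norm d)\<^sup>2 \<le> 0" using key Z_nonneg[OF x'D] by simp
      then have "d = 0" using \<sigma>_pos by (simp add: mult_le_0_iff)
      then show ?thesis using xy by (simp add: d_def feas_def)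
    next
      case False
      have "0 \<le> qq * etar g x' y" using key Z_nonneg[OF x'D] nn by linarith
      then show ?thesis using False qq by (simp add: zero_le_mult_iff)
    qed
    then have "qq * etar g x' y \<le> q * etar g x' y" using Q(2) by (intro mult_right_mono) (auto simp: qq_def)
    with key show "accepts f g h \<sigma> (ereal q) x y (replace_block (B j) z x)"
      unfolding x'_def[symmetric] accepts_def zeta_eq[OF x'D] eta_eq_ereal[OF yc]
      by (simp add: d_def)
  qed
qed

text \<open>Lower semicontinuity bounds the block values from below along \<open>z k\<close>, while
  the proximal inequality bounds them above by a convergent expression. The step sizes need not
  converge; a positive lower bound controls the penalty of the competitor \<open>w\<close>.\<close>

lemma prox_step_limit:
  assumes j: "j \<in> {1..N}" and xs: "xs \<in> D"
    and X: "X \<longlonglongrightarrow> xs" "\<And>k. X k \<in> edom f" and Y: "Y \<longlonglongrightarrow> ys" and q: "q \<longlonglongrightarrow> qs"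
    and \<alpha>: "0 < a" "\<forall>\<^sub>F k in sequentially. a \<le> \<alpha> k"
    and z: "\<And>k. 0 < \<alpha> k \<Longrightarrow> z k \<in> prox_step j (\<alpha> k) (q k) (X k) (Y k)"
    and d: "(\<lambda>k. z k - subvec (B j) (X k)) \<longlonglongrightarrow> 0"
    and w: "w \<in> coord_space (B j)" "fb j w \<noteq> \<infinity>"
  shows "fbr j (subvec (B j) xs) \<le> fbr j w + (grad h xs - qs *\<^sub>R ys) \<bullet> (w - subvec (B j) xs)
    + 1 / (2 * a) * (norm (w - subvec (B j) xs))\<^sup>2"
proof (rule ccontr)
  let ?s = "\<lambda>k. subvec (B j) (X k)" and ?ss = "subvec (B j) xs"
  let ?v = "\<lambda>k. grad h (X k) - q k *\<^sub>R Y k" and ?vs = "grad h xs - qs *\<^sub>R ys"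
  \<comment> \<open>Upper bound for \<open>fbr j (z k)\<close>: the penalty of \<open>z k\<close> is
    dropped and that of \<open>w\<close> is enlarged by using \<open>a\<close> for
    \<open>\<alpha> k\<close>.\<close>
  define R where "R = (\<lambda>k. fbr j w + ?v k \<bullet> (w - ?s k) + 1 / (2 * a) * (norm (w - ?s k))\<^sup>2
    - ?v k \<bullet> (z k - ?s k))"
  have xsD: "xs \<in> edom f" "xs \<in> Omega g" using xs by (auto simp: D_def)
  have "R \<longlonglongrightarrow> fbr j w + ?vs \<bullet> (w - ?ss) + 1 / (2 * a) * (norm (w - ?ss))\<^sup>2 - ?vs \<bullet> 0"
    unfolding R_def
    by (intro tendsto_intros d q Y grad_tendsto[OF xsD(2) X(1)] tendsto_subvec X)
  moreover assume "\<not> ?thesis"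
  then have "fbr j w + ?vs \<bullet> (w - ?ss) + 1 / (2 * a) * (norm (w - ?ss))\<^sup>2 - ?vs \<bullet> 0 < fbr j ?ss" by simp
  then obtain c where c: "fbr j w + ?vs \<bullet> (w - ?ss) + 1 / (2 * a) * (norm (w - ?ss))\<^sup>2 - ?vs \<bullet> 0 < c"
    "c < fbr j ?ss" using dense by blast
  ultimately have R: "\<forall>\<^sub>F k in sequentially. R k < c" by (intro order_tendstoD(2))
  have zs: "z \<longlonglongrightarrow> ?ss"
    using tendsto_add[OF d tendsto_subvec[OF X(1), of "B j"]] by simp
  have fss: "fb j ?ss = ereal (fbr j ?ss)" using fb_eq[OF j _ fb_fin[OF xsD(1) j]] by simp
  then have "ereal c < Liminf (at ?ss within coord_space (B j)) (fb j)"
    using fb_lsc[OF j] c(2) subvec_in_coord_space unfolding lsc_on_def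
    by (metis ereal_less(2) less_ereal.simps(1) less_le_trans)
  then have "\<forall>\<^sub>F u in at ?ss within coord_space (B j). ereal c < fb j u" by (rule less_LiminfD)
  then obtain \<rho> where \<rho>: "\<rho> > 0"
    "\<And>u. u \<in> coord_space (B j) \<Longrightarrow> u \<noteq> ?ss \<Longrightarrow> dist u ?ss < \<rho> \<Longrightarrow> ereal c < fb j u"
    unfolding eventually_at by blast
  have "\<forall>\<^sub>F k in sequentially. dist (z k) ?ss < \<rho>" using tendstoD[OF zs \<rho>(1)] .
  with R \<alpha>(2) have "\<forall>\<^sub>F k in sequentially. False"
  proof eventually_elim
    case (elim k)
    have \<alpha>k: "0 < \<alpha> k" using elim \<alpha>(1) by linarith
    note p = prox_step_ineq[OF j X(2) \<alpha>k z[OF \<alpha>k]]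
    have "ereal c < fb j (z k)"
      using \<rho>(2)[OF p(1)] elim c(2) fss by (cases "z k = ?ss") auto
    then have "c < fbr j (z k)" using fb_eq[OF j p(1,2)] by simp
    moreover have "fbr j (z k) \<le> R k"
    proof -
      have "(norm (w - ?s k))\<^sup>2 / (2 * \<alpha> k) \<le> 1 / (2 * a) * (norm (w - ?s k))\<^sup>2"
        using elim \<alpha>(1) by (simp add: frac_le)
      moreover have "0 \<le> (norm (z k - ?s k))\<^sup>2 / (2 * \<alpha> k)" using \<alpha>k by simp
      ultimately show ?thesis unfolding R_def using p(3)[OF w] by linarith
    qed
    ultimately show False using elim by linarith
  qed
  then show False by simp
qed

section \<open>Frechet subgradients of \<open>f\<close> at the limit\<close>

text \<open>The blockwise quadratic minorants add up, since the block projections of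
  \<open>u - xs\<close> sum to \<open>u - xs\<close>. The resulting quadratic error is of smaller
  order than the distance, so the proximal subgradient is a Frechet subgradient.\<close>

lemma frechet_of_blocks:
  assumes xs: "xs \<in> edom f" and C: "\<And>j. j \<in> {1..N} \<Longrightarrow> 0 \<le> C j"
    and le: "\<And>j w. j \<in> {1..N} \<Longrightarrow> w \<in> coord_space (B j) \<Longrightarrow> fb j w \<noteq> \<infinity> \<Longrightarrow>
      fbr j (subvec (B j) xs) \<le> fbr j w - v \<bullet> (w - subvec (B j) xs) + C j * (norm (w - subvec (B j) xs))\<^sup>2"
  shows "v \<in> frechet_subdiff f xs"
proof (rule frechet_subdiffI)
  define S where "S = (\<Sum>j\<in>{1..N}. C j)"
  have S: "S \<ge> 0" using C by (auto simp: S_def intro: sum_nonneg)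
  have quad: "fr xs \<le> fr u - v \<bullet> (u - xs) + S * (norm (u - xs))\<^sup>2" if u: "u \<in> edom f" for u
  proof -
    have "fr xs \<le> (\<Sum>j\<in>{1..N}. fbr j (subvec (B j) u) - v \<bullet> subvec (B j) (u - xs) + C j * (norm (u - xs))\<^sup>2)"
      unfolding fr_sum[OF xs]
    proof (rule sum_mono)
      fix j assume j: "j \<in> {1..N}"
      have "C j * (norm (subvec (B j) (u - xs)))\<^sup>2 \<le> C j * (norm (u - xs))\<^sup>2"
        using C[OF j] norm_subvec_le by (intro mult_left_mono power_mono) auto
      then show "fbr j (subvec (B j) xs)
          \<le> fbr j (subvec (B j) u) - v \<bullet> subvec (B j) (u - xs) + C j * (norm (u - xs))\<^sup>2"
        using le[OF j subvec_in_coord_space fb_fin[OF u j]] by (simp add: subvec_diff)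
    qed
    also have "\<dots> = fr u - v \<bullet> (\<Sum>j\<in>{1..N}. subvec (B j) (u - xs)) + S * (norm (u - xs))\<^sup>2"
      unfolding fr_sum[OF u] S_def
      by (simp add: sum.distrib sum_subtractf inner_sum_right sum_distrib_right)
    also have "(\<Sum>j\<in>{1..N}. subvec (B j) (u - xs)) = u - xs" by (rule sum_subvec[OF part])
    finally show ?thesis .
  qed
  show "\<bar>f xs\<bar> \<noteq> \<infinity>" using f_eq[OF xs] by simp
  fix \<epsilon> :: real assume \<epsilon>: "\<epsilon> > 0"
  show "\<exists>\<delta>>0. \<forall>u. dist u xs < \<delta> \<longrightarrow> f xs + ereal (v \<bullet> (u - xs) - \<epsilon> * norm (u - xs)) \<le> f u"
  \<comment> \<open>Within this radius \<open>S * norm (u - xs)\<close> is at most \<epsilon>,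
    turning the quadratic error into a linear one; \<open>S + 1\<close> also covers
    \<open>S = 0\<close>.\<close>
  proof (intro exI[of _ "\<epsilon> / (S + 1)"] conjI allI impI)
    show "0 < \<epsilon> / (S + 1)" using \<epsilon> S by simp
    fix u assume u: "dist u xs < \<epsilon> / (S + 1)"
    show "f xs + ereal (v \<bullet> (u - xs) - \<epsilon> * norm (u - xs)) \<le> f u"
    proof (cases "u \<in> edom f")
      case True
      have "S * norm (u - xs) \<le> (S + 1) * norm (u - xs)" by (simp add: mult_right_mono)
      also have "\<dots> \<le> \<epsilon>" using u S by (simp add: dist_norm field_simps)
      finally have "S * (norm (u - xs))\<^sup>2 \<le> \<epsilon> * norm (u - xs)"
        unfolding power2_eq_square mult.assoc[symmetric] by (rule mult_right_mono) simp
      then show ?thesis using quad[OF True] by (simp add: f_eq[OF True] f_eq[OF xs])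
    qed (simp add: edom_def)
  qed
qed

text \<open>Fermat's rule: \<open>f + h\<close> is nonnegative on its domain and vanishes at
  \<open>xs\<close>, which is therefore a minimiser; moving the differentiable part \<open>h\<close>
  across gives the subgradient.\<close>

lemma frechet_of_zero:
  assumes xs: "xs \<in> D" and Z0: "Z xs = 0"
  shows "- grad h xs \<in> frechet_subdiff f xs"
proof (rule frechet_subdiffI)
  have xsD: "xs \<in> edom f" "xs \<in> Omega g" using xs by (auto simp: D_def)
  show "\<bar>f xs\<bar> \<noteq> \<infinity>" using f_eq[OF xsD(1)] by simp
  fix \<epsilon> :: real assume \<epsilon>: "\<epsilon> > 0"
  have "(hr has_derivative (\<lambda>u. u \<bullet> grad h xs)) (at xs)" using hr_GDERIV[OF xsD(2)] by (simp add: gderiv_def)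
  then obtain \<delta>1 where \<delta>1: "\<delta>1 > 0"
    "\<And>u. norm (u - xs) < \<delta>1 \<Longrightarrow> norm (hr u - hr xs - (u - xs) \<bullet> grad h xs) \<le> \<epsilon> * norm (u - xs)"
    using \<epsilon> unfolding has_derivative_at_alt by metis
  obtain \<delta>2 where \<delta>2: "\<delta>2 > 0" "ball xs \<delta>2 \<subseteq> Omega g" using open_Omega xsD(2) openE by blast
  show "\<exists>\<delta>>0. \<forall>u. dist u xs < \<delta> \<longrightarrow> f xs + ereal (- grad h xs \<bullet> (u - xs) - \<epsilon> * norm (u - xs)) \<le> f u"
  proof (intro exI[of _ "min \<delta>1 \<delta>2"] conjI allI impI)
    fix u assume u: "dist u xs < min \<delta>1 \<delta>2"
    show "f xs + ereal (- grad h xs \<bullet> (u - xs) - \<epsilon> * norm (u - xs)) \<le> f u"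
    proof (cases "u \<in> edom f")
      case True
      then have "u \<in> D" using u \<delta>2(2) by (auto simp: D_def dist_commute)
      then have "0 \<le> fr u + hr u" using Z_nonneg by (simp add: Z_def)
      moreover have "\<bar>hr u - hr xs - (u - xs) \<bullet> grad h xs\<bar> \<le> \<epsilon> * norm (u - xs)"
        using \<delta>1(2)[of u] u by (simp add: dist_norm)
      ultimately show ?thesis
        using Z0 by (simp add: f_eq[OF True] f_eq[OF xsD(1)] Z_def inner_commute)
    qed (simp add: edom_def)
  qed (use \<delta>1 \<delta>2 in auto)
qed

end

section \<open>Runs of the algorithm\<close>

text \<open>The set of indices may also contain some before the window. This is harmless, because
  all of them share the maximal value and only that value is used.\<close>

lemma last_max_index_value:
  assumes "\<And>s. s \<le> t \<Longrightarrow> q s = ereal (r s)"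
  shows "q (last_max_index m q t) = ereal (Max (r ` {t - m..t}))"
proof -
  let ?A = "{j. j \<le> t \<and> q j = Max (q ` {t - m..t})}"
  have "Max (q ` {t - m..t}) \<in> q ` {t - m..t}" by (intro Max_in) auto
  then obtain s where "s \<in> {t - m..t}" "Max (q ` {t - m..t}) = q s" by blast
  then have "s \<in> ?A" by simp
  then have ne: "?A \<noteq> {}" by blast
  have fin: "finite ?A" by simp
  have "last_max_index m q t \<in> ?A" unfolding last_max_index_def by (rule Max_in[OF fin ne])
  then have "q (last_max_index m q t) = Max (q ` {t - m..t})" by simp
  also have "q ` {t - m..t} = ereal ` r ` {t - m..t}" using assms by (auto simp: image_image)
  also have "Max (ereal ` r ` {t - m..t}) = ereal (Max (r ` {t - m..t}))"
    by (rule mono_Max_commute[symmetric]) (auto simp: mono_def)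
  finally show ?thesis .
qed

text \<open>A single deterministic run with an arbitrary sequence of picks; randomness will enter
  only through the existence of suitable subsequences.\<close>

locale mpga = fractional_program f h g N B fb \<sigma>
  for f h :: "real^'n \<Rightarrow> ereal" and g :: "real^'n \<Rightarrow> real"
    and N :: nat and B :: "nat \<Rightarrow> 'n set" and fb :: "nat \<Rightarrow> real^'n \<Rightarrow> ereal" and \<sigma> :: real +
  fixes \<alpha>lo \<alpha>hi \<gamma> :: real and m :: nat and x0 y0 :: "real^'n"
    and i :: "nat \<Rightarrow> nat" and x y :: "nat \<Rightarrow> real^'n"
  assumes run: "MPGA_run N B fb f g h \<alpha>lo \<alpha>hi \<sigma> \<gamma> m x0 y0 i x y"
    and x0: "x0 \<in> edom (Fobj f g h)" and y0: "y0 \<in> subdiff g x0"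
    and \<alpha>lo: "0 < \<alpha>lo" and \<gamma>: "0 < \<gamma>" "\<gamma> < 1"
begin

definition "qr t = Qr (x t) (y t)"
definition "R t = Max (qr ` {t - m..t})"

text \<open>Because \<open>y0\<close> is a subgradient at \<open>x0\<close>, Fenchel-Young holds
  with equality, so the initial \<open>Q\<close> equals the initial \<open>F\<close>.\<close>

lemma start: "feas (x 0) (y 0)" "qr 0 = Z x0 / g x0" "x 0 = x0"
proof -
  have xy: "x 0 = x0" "y 0 = y0" using run by (auto simp: MPGA_run_def)
  have D0: "x0 \<in> D" using x0 edom_Fobj by simp
  have "etar g x0 y0 = g x0" using conjugate_subdiff[OF y0] by (simp add: etar_def)
  then show "feas (x 0) (y 0)" "qr 0 = Z x0 / g x0"
    using g_pos[OF D0] conjugate_subdiff[OF y0] D0 by (auto simp: xy feas_def D_def edom_def qr_def Qr_def)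
  show "x 0 = x0" by (rule xy)
qed

lemma R_ge: "t - m \<le> s \<Longrightarrow> s \<le> t \<Longrightarrow> qr s \<le> R t"
  unfolding R_def by (rule Max_ge) auto

text \<open>The backtracking history is condensed to what a lower bound on step sizes requires:
  either the final step is at least \<open>\<alpha>lo\<close>, or a candidate for the step larger by
  the factor \<open>1 / \<gamma>\<close> was rejected.\<close>

lemma iter_cases:
  assumes feas: "\<And>s. s \<le> t \<Longrightarrow> feas (x s) (y s)"
  obtains (Y) \<alpha> where "i t = 0" "\<alpha>lo \<le> \<alpha>" "step_Y g \<alpha> (x t, y t) (x (Suc t), y (Suc t))"
  | (X) \<alpha> z where "i t \<in> {1..N}" "0 < \<alpha>" "z \<in> prox_step (i t) \<alpha> (qr t) (x t) (y t)"
      "x (Suc t) = replace_block (B (i t)) z (x t)" "y (Suc t) = y t"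
      "accepts f g h \<sigma> (ereal (R t)) (x t) (y t) (x (Suc t))"
      "\<alpha>lo \<le> \<alpha> \<or> (\<exists>z'\<in>prox_step (i t) (\<alpha> / \<gamma>) (qr t) (x t) (y t).
        \<not> accepts f g h \<sigma> (ereal (R t)) (x t) (y t) (replace_block (B (i t)) z' (x t)))"
proof -
  define q where "q = (\<lambda>s. Qobj f g h (x s) (y s))"
  have q: "q s = ereal (qr s)" if "s \<le> t" for s using Qobj_eq[OF feas[OF that]] by (simp add: q_def qr_def)
  have ql: "q (last_max_index m q t) = ereal (R t)" unfolding R_def by (rule last_max_index_value) (rule q)
  have it: "i t \<in> {0..N}" and ex: "\<exists>\<alpha>\<in>{\<alpha>lo..\<alpha>hi}.
      if i t = 0 then step_Y g \<alpha> (x t, y t) (x (Suc t), y (Suc t))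
      else step_X (B (i t)) (fb (i t)) f g h \<sigma> \<gamma> \<alpha> (q t) (q (last_max_index m q t)) (x t, y t) (x (Suc t), y (Suc t))"
    using run unfolding MPGA_run_def Let_def q_def by blast+
  obtain \<alpha> where \<alpha>: "\<alpha>lo \<le> \<alpha>" "if i t = 0 then step_Y g \<alpha> (x t, y t) (x (Suc t), y (Suc t))
      else step_X (B (i t)) (fb (i t)) f g h \<sigma> \<gamma> \<alpha> (ereal (qr t)) (ereal (R t)) (x t, y t) (x (Suc t), y (Suc t))"
    using ex unfolding ql q[OF order_refl] by auto
  show ?thesis
  proof (cases "i t = 0")
    case True
    then show ?thesis using \<alpha> Y by auto
  next
    case False
    then obtain z K where zK: "\<And>k. k \<le> K \<Longrightarrow> z k \<in> prox_step (i t) (\<alpha> * \<gamma> ^ k) (qr t) (x t) (y t)"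
       "\<And>k. k < K \<Longrightarrow> \<not> accepts f g h \<sigma> (ereal (R t)) (x t) (y t) (replace_block (B (i t)) (z k) (x t))"
       "accepts f g h \<sigma> (ereal (R t)) (x t) (y t) (replace_block (B (i t)) (z K) (x t))"
       "x (Suc t) = replace_block (B (i t)) (z K) (x t)" "y (Suc t) = y t"
      using \<alpha>(2) unfolding step_X_def prox_step_def by auto
    have last: "\<alpha>lo \<le> \<alpha> * \<gamma> ^ K \<or> (\<exists>z'\<in>prox_step (i t) (\<alpha> * \<gamma> ^ K / \<gamma>) (qr t) (x t) (y t).
        \<not> accepts f g h \<sigma> (ereal (R t)) (x t) (y t) (replace_block (B (i t)) z' (x t)))"
    proof (cases K)
      case 0
      then show ?thesis using \<alpha> by simp
    next
      case (Suc k)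
      then have "\<alpha> * \<gamma> ^ K / \<gamma> = \<alpha> * \<gamma> ^ k" using \<gamma> by simp
      then show ?thesis using zK(1)[of k] zK(2)[of k] Suc by auto
    qed
    show ?thesis
      by (rule X[of "\<alpha> * \<gamma> ^ K" "z K"]) (use False it zK \<alpha> \<alpha>lo \<gamma> last in auto)
  qed
qed

text \<open>Feasibility of all earlier iterates is assumed since the reference value reads a whole
  window of values of \<open>Q\<close>; \<open>feas_run\<close> discharges it by strong
  induction.\<close>

lemma Q_step:
  assumes feas: "\<And>s. s \<le> t \<Longrightarrow> feas (x s) (y s)"
  shows "feas (x (Suc t)) (y (Suc t))" "qr (Suc t) \<le> R t" "i t = 0 \<Longrightarrow> qr (Suc t) \<le> qr t"
    "i t \<noteq> 0 \<Longrightarrow> qr (Suc t) + \<sigma> / 2 * (norm (x (Suc t) - x t))\<^sup>2 / g (x (Suc t)) \<le> R t"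
proof -
  have ft: "feas (x t) (y t)" and q0: "0 \<le> qr t" using feas[of t] Qr_nonneg by (auto simp: qr_def)
  have R0: "0 \<le> R t" using q0 R_ge[of t t] by simp
  have "feas (x (Suc t)) (y (Suc t)) \<and> qr (Suc t) \<le> R t \<and> (i t = 0 \<longrightarrow> qr (Suc t) \<le> qr t) \<and>
    (i t \<noteq> 0 \<longrightarrow> qr (Suc t) + \<sigma> / 2 * (norm (x (Suc t) - x t))\<^sup>2 / g (x (Suc t)) \<le> R t)"
  proof (rule iter_cases[of t, OF feas])
    fix \<alpha> assume Y: "i t = 0" "\<alpha>lo \<le> \<alpha>" "step_Y g \<alpha> (x t, y t) (x (Suc t), y (Suc t))"
    have yt: "y t \<in> edom (conjugate g)" using ft by (simp add: feas_def)
    note p = step_Y_props[OF Y(3) yt]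
    have \<alpha>: "0 < \<alpha>" using Y \<alpha>lo by linarith
    have "etar g (x t) (y t) \<le> etar g (x t) (y (Suc t)) - (norm (y (Suc t) - y t))\<^sup>2 / (2 * \<alpha>)"
      using p(3)[OF \<alpha> yt] by simp
    also have "\<dots> \<le> etar g (x t) (y (Suc t))" using \<alpha> by simp
    finally have e: "etar g (x t) (y t) \<le> etar g (x t) (y (Suc t))" .
    then have fs: "feas (x (Suc t)) (y (Suc t))" using ft p(1,2)[OF \<alpha>] by (auto simp: feas_def)
    have "qr (Suc t) \<le> qr t"
      unfolding qr_def Qr_def p(1)[OF \<alpha>] using e ft Z_nonneg[OF feas_D[OF ft]]
      by (intro divide_left_mono mult_pos_pos) (auto simp: feas_def)
    then show ?thesis using fs Y(1) R_ge[of t t] by auto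
  next
    assume X: "i t \<in> {1..N}" "y (Suc t) = y t"
      "accepts f g h \<sigma> (ereal (R t)) (x t) (y t) (x (Suc t))"
    note a = accepts_feas[OF ft R0 X(3)]
    have fs: "feas (x (Suc t)) (y (Suc t))" using a(1) X(2) by simp
    have e: "0 < etar g (x (Suc t)) (y (Suc t))" using fs by (simp add: feas_def)
    let ?n = "\<sigma> / 2 * (norm (x (Suc t) - x t))\<^sup>2"
    have "(Z (x (Suc t)) + ?n) / etar g (x (Suc t)) (y (Suc t)) \<le> R t"
      using a(2) e unfolding X(2)[symmetric] by (simp only: pos_divide_le_eq)
    then have "qr (Suc t) + ?n / etar g (x (Suc t)) (y (Suc t)) \<le> R t"
      by (simp only: qr_def Qr_def add_divide_distrib)
    \<comment> \<open>The gain is weakened from division by \<open>etar\<close> to division by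
      \<open>g\<close>, which can be bounded above on the level set.\<close>
    moreover have "?n / g (x (Suc t)) \<le> ?n / etar g (x (Suc t)) (y (Suc t))"
      using e fs \<sigma>_pos g_pos[OF feas_D[OF fs]] etar_le_self[of "y (Suc t)" g "x (Suc t)"]
      by (intro divide_left_mono mult_pos_pos) (auto simp: feas_def)
    moreover have "0 \<le> ?n / g (x (Suc t))" using g_pos[OF feas_D[OF fs]] \<sigma>_pos by simp
    ultimately show ?thesis using fs X(1) by auto
  qed
  then show "feas (x (Suc t)) (y (Suc t))" "qr (Suc t) \<le> R t" "i t = 0 \<Longrightarrow> qr (Suc t) \<le> qr t"
    "i t \<noteq> 0 \<Longrightarrow> qr (Suc t) + \<sigma> / 2 * (norm (x (Suc t) - x t))\<^sup>2 / g (x (Suc t)) \<le> R t"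
    by auto
qed

lemma feas_run: "feas (x t) (y t)"
proof (induction t rule: less_induct)
  case (less t)
  then show ?case using start(1) Q_step(1)[of "t - 1"] by (cases t) auto
qed

lemmas qr_Suc_le_R = Q_step(2)[OF feas_run]
lemmas qr_Suc_le_qr = Q_step(3)[OF feas_run]
lemmas qr_Suc_descent = Q_step(4)[OF feas_run]

lemma D_run: "x t \<in> D"
  using feas_D[OF feas_run] .

lemma qr_nonneg: "0 \<le> qr t"
  using Qr_nonneg[OF feas_run] by (simp add: qr_def)

lemma qr_le_R: "qr t \<le> R t"
  by (rule R_ge) auto

text \<open>Moving the window adds only \<open>qr (Suc t)\<close>, which is at most the old
  maximum.\<close>

lemma R_decseq: "decseq R"
proof (rule decseq_SucI)
  fix t
  show "R (Suc t) \<le> R t"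
    unfolding R_def[of "Suc t"]
  proof (rule Max.boundedI)
    fix a assume "a \<in> qr ` {Suc t - m..Suc t}"
    then obtain s where s: "Suc t - m \<le> s" "s \<le> Suc t" "a = qr s" by auto
    then show "a \<le> R t" using qr_Suc_le_R[of t] R_ge[of t s] by (cases "s = Suc t") auto
  qed auto
qed

lemma R_convergent: obtains Rs where "R \<longlonglongrightarrow> Rs"
  using decseq_convergent[OF R_decseq, of 0] order_trans[OF qr_nonneg qr_le_R] by blast

text \<open>After \<open>m\<close> Y-steps the window is exactly \<open>t + 1\<close> to
  \<open>t + m + 1\<close>, and along it \<open>qr\<close> never rises above its first
  value.\<close>

lemma R_after_Y_steps:
  assumes "\<And>s. s \<in> {1..m} \<Longrightarrow> i (t + s) = 0"
  shows "R (t + m + 1) \<le> qr (t + 1)"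
proof -
  have "qr (t + 1 + k) \<le> qr (t + 1)" if "k \<le> m" for k
    using that
  proof (induction k)
    case (Suc k)
    then show ?case using qr_Suc_le_qr[of "t + 1 + k"] assms[of "Suc k"] by auto
  qed simp
  note * = this
  show ?thesis unfolding R_def
  proof (rule Max.boundedI)
    fix a assume "a \<in> qr ` {t + m + 1 - m..t + m + 1}"
    then obtain s where s: "t + 1 \<le> s" "s \<le> t + m + 1" "a = qr s" by auto
    then show "a \<le> qr (t + 1)" using *[of "s - (t + 1)"] by simp
  qed auto
qed

text \<open>Chain \<open>F \<le> Q \<le> R t \<le> R 0\<close>, where \<open>R 0\<close> is the
  initial \<open>F\<close>; hence all iterates stay in the level set.\<close>

lemma F_le_F0: "Fobj f g h (x t) \<le> Fobj f g h x0"
proof -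
  have "Z (x t) / g (x t) \<le> qr t" using F_le_Q[OF feas_run] by (simp add: qr_def)
  also have "\<dots> \<le> R 0" using qr_le_R[of t] decseqD[OF R_decseq, of 0 t] by simp
  also have "R 0 = Z x0 / g x0" using start(2) by (simp add: R_def)
  finally show ?thesis using Fobj_eq[OF D_run] Fobj_eq[of x0] start(3) D_run[of 0] by simp
qed

section \<open>Limits along good subsequences\<close>

definition "good_subseq xs ys j r \<longleftrightarrow> strict_mono r \<and> (\<lambda>k. x (r k)) \<longlonglongrightarrow> xs \<and> (\<lambda>k. y (r k)) \<longlonglongrightarrow> ys \<and>
  (\<forall>k. i (r k) = j \<and> (\<forall>s\<in>{1..m}. i (r k + s) = 0))"

context
  fixes xs ys :: "real^'n" and Rs :: real
  assumes compact: "compact {u. Fobj f g h u \<le> Fobj f g h x0}"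
    and good: "\<And>j. j \<in> {0..N} \<Longrightarrow> \<exists>r. good_subseq xs ys j r"
    and Rs: "R \<longlonglongrightarrow> Rs"
begin

lemma level_D: "{u. Fobj f g h u \<le> Fobj f g h x0} \<subseteq> D"
  using x0 unfolding edom_Fobj[symmetric] edom_def by auto

text \<open>The compact level set is closed, so it contains the limit of the iterates.\<close>

lemma xs_D: "xs \<in> D"
proof -
  obtain r where "(\<lambda>k. x (r k)) \<longlonglongrightarrow> xs" using good[of 0] by (auto simp: good_subseq_def)
  then have "xs \<in> {u. Fobj f g h u \<le> Fobj f g h x0}"
    by (rule Lim_in_closed_set[OF compact_imp_closed[OF compact], rotated 2]) (auto simp: F_le_F0)
  then show ?thesis using level_D by blast
qed

lemma Rs_nonneg: "0 \<le> Rs"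
  using Rs qr_nonneg qr_le_R by (meson LIMSEQ_le_const order_trans)

text \<open>The last limit is the purpose of the pattern: \<open>qr (r k + 1)\<close> lies between
  \<open>R (r k + m + 1)\<close> and \<open>R (r k)\<close>, which have the same limit.\<close>

lemma good_limits:
  assumes r: "good_subseq xs ys j r"
  shows "(\<lambda>k. x (r k)) \<longlonglongrightarrow> xs" "(\<lambda>k. y (r k)) \<longlonglongrightarrow> ys" "i (r k) = j"
    "(\<lambda>k. Z (x (r k))) \<longlonglongrightarrow> Z xs" "(\<lambda>k. g (x (r k))) \<longlonglongrightarrow> g xs"
    "(\<lambda>k. R (r k)) \<longlonglongrightarrow> Rs" "(\<lambda>k. qr (r k + 1)) \<longlonglongrightarrow> Rs"
proof -
  have sm: "strict_mono r" and pat: "\<And>k s. s \<in> {1..m} \<Longrightarrow> i (r k + s) = 0" and ir: "\<And>k. i (r k) = j"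
    using r by (auto simp: good_subseq_def)
  show x: "(\<lambda>k. x (r k)) \<longlonglongrightarrow> xs" and "(\<lambda>k. y (r k)) \<longlonglongrightarrow> ys" and "i (r k) = j"
    using r by (auto simp: good_subseq_def)
  show "(\<lambda>k. Z (x (r k))) \<longlonglongrightarrow> Z xs"
    by (rule Z_tendsto[OF xs_D x]) (simp add: D_run)
  show "(\<lambda>k. g (x (r k))) \<longlonglongrightarrow> g xs" by (rule g_tendsto[OF x])
  show Rr: "(\<lambda>k. R (r k)) \<longlonglongrightarrow> Rs" using LIMSEQ_subseq_LIMSEQ[OF Rs sm] by (simp add: o_def)
  have "strict_mono (\<lambda>k. r k + m + 1)" using sm by (simp add: strict_mono_def)
  then have Rm: "(\<lambda>k. R (r k + m + 1)) \<longlonglongrightarrow> Rs" using LIMSEQ_subseq_LIMSEQ[OF Rs] by (simp add: o_def)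
  show "(\<lambda>k. qr (r k + 1)) \<longlonglongrightarrow> Rs"
    by (rule real_tendsto_sandwich[OF _ _ Rm Rr])
      (use R_after_Y_steps[OF pat] qr_Suc_le_R in auto)
qed

lemma F_le_Rs: "Z xs / g xs \<le> Rs"
proof -
  obtain r where r: "good_subseq xs ys 0 r" using good[of 0] by auto
  note l = good_limits[OF r]
  have "(\<lambda>k. Z (x (r k)) / g (x (r k))) \<longlonglongrightarrow> Z xs / g xs"
    using l g_pos[OF xs_D] by (intro tendsto_intros) auto
  then show ?thesis
    using l(6) F_le_Q[OF feas_run] qr_le_R unfolding qr_def[symmetric]
    by (intro LIMSEQ_le) (auto intro: order_trans)
qed

text \<open>A proximal step in \<open>y\<close> towards a subgradient \<open>v\<close> would decrease \<open>Q\<close> by a fixed factor as long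
  as \<open>\<eta>\<close> stays away from \<open>g\<close>.\<close>

lemma eta_tendsto:
  assumes Rs_pos: "0 < Rs" and r: "good_subseq xs ys 0 r"
  shows "(\<lambda>k. etar g (x (r k)) (y (r k))) \<longlonglongrightarrow> g xs" "(\<lambda>k. qr (r k)) \<longlonglongrightarrow> Rs"
proof -
  note l = good_limits[OF r]
  define e where "e k = etar g (x (r k)) (y (r k))" for k
  \<comment> \<open>Ratio of \<open>Q\<close> before and after the Y-step. As \<open>Z\<close> is
    unchanged by that step, it is also the factor by which \<open>etar\<close> grows.\<close>
  define \<rho> where "\<rho> k = qr (r k) / qr (r k + 1)" for k
  have qr0: "(\<lambda>k. qr (r k)) \<longlonglongrightarrow> Rs"
    by (rule real_tendsto_sandwich[OF _ _ l(7) l(6)])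
      (use qr_Suc_le_qr[OF l(3)] qr_le_R in auto)
  then show "(\<lambda>k. qr (r k)) \<longlonglongrightarrow> Rs" .
  have \<rho>: "\<rho> \<longlonglongrightarrow> 1"
    unfolding \<rho>_def using tendsto_divide[OF qr0 l(7)] Rs_pos by simp
  obtain v where v: "v \<in> subdiff g xs" using subgradient_exists[OF g_convex] by blast
  have vc: "v \<in> edom (conjugate g)" using conjugate_subdiff[OF v] by (simp add: edom_def)
  have ev: "(\<lambda>k. etar g (x (r k)) v) \<longlonglongrightarrow> g xs"
  proof -
    have "(\<lambda>k. etar g (x (r k)) v) \<longlonglongrightarrow> etar g xs v" unfolding etar_def by (intro tendsto_intros l)
    moreover have "etar g xs v = g xs" using conjugate_subdiff[OF v] by (simp add: etar_def)
    ultimately show ?thesis by simp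
  qed
  \<comment> \<open>The competitor \<open>w\<close> moves a fraction \<open>s\<close> from
    \<open>y\<close> towards \<open>v\<close>. The gain in \<open>etar\<close> is of order
    \<open>s\<close> by concavity, while the penalty is of order \<open>s\<close> squared; the
    inequality is then divided by \<open>s\<close>.\<close>
  have low: "\<forall>\<^sub>F k in sequentially. etar g (x (r k)) v - g (x (r k)) * (\<rho> k - 1) / s
      - s * ((norm (v - y (r k)))\<^sup>2 / (2 * \<alpha>lo)) \<le> e k" if s: "0 < s" "s \<le> 1" for s
  proof -
    have "\<forall>\<^sub>F k in sequentially. 0 < qr (r k + 1)" using order_tendstoD(1)[OF l(7) Rs_pos] .
    then show ?thesis
    proof eventually_elim
      case (elim k)
      let ?x = "x (r k)" and ?y = "y (r k)" and ?y' = "y (Suc (r k))"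
      have yc: "?y \<in> edom (conjugate g)" using feas_run by (simp add: feas_def)
      define w where "w = (1 - s) *\<^sub>R ?y + s *\<^sub>R v"
      have w: "w \<in> edom (conjugate g)" "(1 - s) * e k + s * etar g ?x v \<le> etar g ?x w"
        using etar_convex_comb[OF yc vc, of s] s by (auto simp: w_def e_def)
      have xeq: "x (Suc (r k)) = ?x"
        and st: "etar g ?x w - (norm (w - ?y))\<^sup>2 / (2 * \<alpha>lo) \<le> etar g ?x ?y'"
      proof -
        from feas_run obtain \<alpha> where \<alpha>: "\<alpha>lo \<le> \<alpha>" "step_Y g \<alpha> (?x, ?y) (x (Suc (r k)), ?y')"
          by (rule iter_cases[of "r k"]) (use l(3) in auto)
        have \<alpha>0: "0 < \<alpha>" using \<alpha> \<alpha>lo by linarith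
        note p = step_Y_props[OF \<alpha>(2) yc \<alpha>0]
        show "x (Suc (r k)) = ?x" by (rule p(1))
        have "(norm (w - ?y))\<^sup>2 / (2 * \<alpha>) \<le> (norm (w - ?y))\<^sup>2 / (2 * \<alpha>lo)"
          using \<alpha>(1) \<alpha>lo by (intro divide_left_mono mult_pos_pos) auto
        moreover have "0 \<le> (norm (?y' - ?y))\<^sup>2 / (2 * \<alpha>)" using \<alpha>0 by simp
        ultimately show "etar g ?x w - (norm (w - ?y))\<^sup>2 / (2 * \<alpha>lo) \<le> etar g ?x ?y'"
          using p(3)[OF w(1)] by linarith
      qed
      have "w - ?y = s *\<^sub>R (v - ?y)" by (simp add: w_def algebra_simps)
      then have nw: "(norm (w - ?y))\<^sup>2 = s\<^sup>2 * (norm (v - ?y))\<^sup>2" by (simp add: power_mult_distrib)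
      have e': "etar g ?x ?y' = \<rho> k * e k"
      proof -
        have "qr (r k) * e k = qr (r k + 1) * etar g ?x ?y'"
          using Z_eq[OF feas_run, of "r k"] Z_eq[OF feas_run, of "Suc (r k)"] xeq
          by (simp add: qr_def e_def)
        then show ?thesis using elim by (simp add: \<rho>_def field_simps)
      qed
      have "1 \<le> \<rho> k" using qr_Suc_le_qr[OF l(3), of k] elim by (simp add: \<rho>_def)
      moreover have "e k \<le> g ?x" using etar_le_self[OF yc] by (simp add: e_def)
      ultimately have "e k * (\<rho> k - 1) \<le> g ?x * (\<rho> k - 1)" by (intro mult_right_mono) auto
      then have "s * etar g ?x v - g ?x * (\<rho> k - 1) - s\<^sup>2 * ((norm (v - ?y))\<^sup>2 / (2 * \<alpha>lo)) \<le> s * e k"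
        using w(2) st e' nw by (simp add: algebra_simps)
      moreover have "s * (A - b / s - s * c) = s * A - b - s\<^sup>2 * c" for A b c
        using s by (simp add: right_diff_distrib power2_eq_square)
      ultimately have "s * (etar g ?x v - g ?x * (\<rho> k - 1) / s - s * ((norm (v - ?y))\<^sup>2 / (2 * \<alpha>lo))) \<le> s * e k"
        by (simp only:)
      then show ?case using s by simp
    qed
  qed
  define c where "c = (norm (v - ys))\<^sup>2 / (2 * \<alpha>lo)"
  have c: "c \<ge> 0" using \<alpha>lo by (simp add: c_def)
  show "(\<lambda>k. etar g (x (r k)) (y (r k))) \<longlonglongrightarrow> g xs"
    unfolding e_def[symmetric]
  proof (rule order_tendstoI)
    fix a assume a: "a < g xs"
    \<comment> \<open>First \<open>s\<close> is fixed so small that the penalty limit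
      \<open>s * c\<close> stays below the gap \<open>g xs - a\<close>; only then does
      \<open>k\<close> grow, which removes the term with \<open>\<rho> k - 1\<close> despite its
      division by \<open>s\<close>.\<close>
    define s where "s = min 1 ((g xs - a) / (2 * (c + 1)))"
    have s: "0 < s" "s \<le> 1" using a c by (auto simp: s_def)
    have "s * c \<le> (g xs - a) / (2 * (c + 1)) * c" using c by (intro mult_right_mono) (auto simp: s_def)
    also have "\<dots> = (g xs - a) * (c / (2 * (c + 1)))" by simp
    also have "\<dots> < (g xs - a) * 1" using a c by (intro mult_strict_left_mono) auto
    finally have sc: "s * c < g xs - a" by simp
    have "(\<lambda>k. etar g (x (r k)) v - g (x (r k)) * (\<rho> k - 1) / s - s * ((norm (v - y (r k)))\<^sup>2 / (2 * \<alpha>lo)))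
      \<longlonglongrightarrow> g xs - g xs * (1 - 1) / s - s * c"
      unfolding c_def using s \<alpha>lo by (intro tendsto_intros ev l \<rho>) auto
    then have "\<forall>\<^sub>F k in sequentially. a < etar g (x (r k)) v - g (x (r k)) * (\<rho> k - 1) / s
        - s * ((norm (v - y (r k)))\<^sup>2 / (2 * \<alpha>lo))"
      by (rule order_tendstoD) (use sc in simp)
    with low[OF s] show "\<forall>\<^sub>F k in sequentially. a < e k" by eventually_elim linarith
  next
    fix a assume "g xs < a"
    then have "\<forall>\<^sub>F k in sequentially. g (x (r k)) < a" using order_tendstoD(2)[OF l(5)] by blast
    moreover have "e k \<le> g (x (r k))" for k using etar_le_self feas_run by (auto simp: e_def feas_def)
    ultimately show "\<forall>\<^sub>F k in sequentially. e k < a" by (auto elim!: eventually_mono intro: le_less_trans)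
  qed
qed

text \<open>The identity of \<open>Z\<close> with \<open>Q\<close> times \<open>etar\<close> passes
  to the limit and identifies \<open>F\<close> at \<open>xs\<close>. Passing \<open>etar_le\<close>
  to the limit for every \<open>z\<close> gives the subgradient inequality.\<close>

lemma limit_values:
  assumes Rs_pos: "0 < Rs"
  shows "Z xs / g xs = Rs" "ys \<in> subdiff g xs"
proof -
  obtain r where r: "good_subseq xs ys 0 r" using good[of 0] by auto
  note l = good_limits[OF r] and e = eta_tendsto[OF Rs_pos r]
  have "(\<lambda>k. qr (r k) * etar g (x (r k)) (y (r k))) \<longlonglongrightarrow> Rs * g xs" by (intro tendsto_intros e)
  moreover have "qr t * etar g (x t) (y t) = Z (x t)" for t using Z_eq[OF feas_run] by (simp add: qr_def)
  ultimately have "Z xs = Rs * g xs" using l(4) LIMSEQ_unique by auto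
  then show "Z xs / g xs = Rs" using g_pos[OF xs_D] by simp
  show "ys \<in> subdiff g xs"
    unfolding subdiff_def
  proof (intro CollectI allI)
    fix z
    have "etar g (x (r k)) (y (r k)) \<le> x (r k) \<bullet> y (r k) - z \<bullet> y (r k) + g z" for k
      using etar_le[of "y (r k)" g "x (r k)" z] feas_run[of "r k"] by (simp add: feas_def)
    moreover have "(\<lambda>k. x (r k) \<bullet> y (r k) - z \<bullet> y (r k) + g z) \<longlonglongrightarrow> xs \<bullet> ys - z \<bullet> ys + g z"
      by (intro tendsto_intros l)
    ultimately have "g xs \<le> xs \<bullet> ys - z \<bullet> ys + g z" using LIMSEQ_le[OF e(1)] by blast
    then show "g xs + ys \<bullet> (z - xs) \<le> g z" by (simp add: inner_diff_right inner_commute)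
  qed
qed

text \<open>Uses the subsequence on which block \<open>j\<close> is picked: the decrease in
  \<open>Q\<close> forces vanishing steps, the step sizes stay bounded below, and
  \<open>prox_step_limit\<close> applies.\<close>

lemma block_stationary:
  assumes Rs_pos: "0 < Rs" and j: "j \<in> {1..N}"
  obtains C where "0 \<le> C" "\<And>w. w \<in> coord_space (B j) \<Longrightarrow> fb j w \<noteq> \<infinity> \<Longrightarrow>
    fbr j (subvec (B j) xs) \<le> fbr j w + (grad h xs - Rs *\<^sub>R ys) \<bullet> (w - subvec (B j) xs)
      + C * (norm (w - subvec (B j) xs))\<^sup>2"
proof -
  obtain r where r: "good_subseq xs ys j r" using good[of j] j by auto
  note l = good_limits[OF r]
  have FRs: "(\<lambda>k. Z (x (r k)) / g (x (r k))) \<longlonglongrightarrow> Rs"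
    using tendsto_divide[OF l(4,5)] g_pos[OF xs_D] limit_values(1)[OF Rs_pos] by simp
  \<comment> \<open>The step at \<open>r k\<close> is not of type Y here, so
    \<open>qr (r k + 1)\<close> does not bound \<open>qr (r k)\<close> from below. The lower bound
    \<open>F\<close> serves instead, its limit \<open>Rs\<close> being known from the subsequence
    for pick 0.\<close>
  have qr: "(\<lambda>k. qr (r k)) \<longlonglongrightarrow> Rs"
    by (rule real_tendsto_sandwich[OF _ _ FRs l(6)])
      (use F_le_Q[OF feas_run] qr_le_R in \<open>auto simp: qr_def\<close>)
  \<comment> \<open>A uniform upper bound on \<open>g\<close> over the compact level set turns the
    decrease divided by \<open>g\<close> into a bound on the step length.\<close>
  obtain G where G: "0 < G" "\<And>t. g (x t) \<le> G"
  proof -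
    have "bounded (g ` {u. Fobj f g h u \<le> Fobj f g h x0})"
      by (intro compact_imp_bounded compact_continuous_image g_cont compact)
    then obtain G where "\<And>u. Fobj f g h u \<le> Fobj f g h x0 \<Longrightarrow> norm (g u) \<le> G"
      unfolding bounded_iff by blast
    then have "g (x t) \<le> max 1 G" for t using F_le_F0[of t] by fastforce
    then show ?thesis by (rule that[rotated]) simp
  qed
  have d0: "(\<lambda>k. x (Suc (r k)) - x (r k)) \<longlonglongrightarrow> 0"
  proof -
    let ?b = "\<lambda>k. 2 * G / \<sigma> * (R (r k) - qr (r k + 1))"
    have "?b \<longlonglongrightarrow> 2 * G / \<sigma> * (Rs - Rs)" by (intro tendsto_intros l)
    then have b0: "?b \<longlonglongrightarrow> 0" by simp
    have bound: "(norm (x (Suc (r k)) - x (r k)))\<^sup>2 \<le> ?b k" for k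
    proof -
      let ?n = "(norm (x (Suc (r k)) - x (r k)))\<^sup>2"
      have "\<sigma> / 2 * ?n / G \<le> \<sigma> / 2 * ?n / g (x (Suc (r k)))"
        using G g_pos[OF D_run] \<sigma>_pos by (intro divide_left_mono mult_pos_pos) auto
      also have "\<dots> \<le> R (r k) - qr (r k + 1)" using qr_Suc_descent[of "r k"] l(3) j by simp
      finally show ?thesis using G \<sigma>_pos by (simp add: field_simps)
    qed
    have "(\<lambda>k. (norm (x (Suc (r k)) - x (r k)))\<^sup>2) \<longlonglongrightarrow> 0"
      by (rule real_tendsto_sandwich[OF _ _ tendsto_const b0]) (simp_all only: bound zero_le_power2 eventually_True)
    then have "(\<lambda>k. sqrt ((norm (x (Suc (r k)) - x (r k)))\<^sup>2)) \<longlonglongrightarrow> sqrt 0" by (rule tendsto_real_sqrt)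
    then show ?thesis by (simp add: tendsto_norm_zero_iff)
  qed
  define A where "A k \<alpha> z \<longleftrightarrow> 0 < \<alpha> \<and> z \<in> prox_step j \<alpha> (qr (r k)) (x (r k)) (y (r k)) \<and>
      x (Suc (r k)) = replace_block (B j) z (x (r k)) \<and>
      (\<alpha>lo \<le> \<alpha> \<or> (\<exists>z'\<in>prox_step j (\<alpha> / \<gamma>) (qr (r k)) (x (r k)) (y (r k)).
        \<not> accepts f g h \<sigma> (ereal (R (r k))) (x (r k)) (y (r k)) (replace_block (B j) z' (x (r k)))))"
    for k \<alpha> z
  have "\<exists>\<alpha> z. A k \<alpha> z" for k
    unfolding A_def by (rule iter_cases[OF feas_run, of "r k"]) (use l(3) j in auto)
  then obtain \<alpha> z where "\<And>k. A k (\<alpha> k) (z k)" by metis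
  then have \<alpha>: "\<And>k. 0 < \<alpha> k" and z: "\<And>k. z k \<in> prox_step j (\<alpha> k) (qr (r k)) (x (r k)) (y (r k))"
    and x': "\<And>k. x (Suc (r k)) = replace_block (B j) (z k) (x (r k))"
    and bt: "\<And>k. \<alpha>lo \<le> \<alpha> k \<or> (\<exists>z'\<in>prox_step j (\<alpha> k / \<gamma>) (qr (r k)) (x (r k)) (y (r k)).
        \<not> accepts f g h \<sigma> (ereal (R (r k))) (x (r k)) (y (r k)) (replace_block (B j) z' (x (r k))))"
    unfolding A_def by blast+
  have xf: "x t \<in> edom f" for t using D_run by (auto simp: D_def)
  have nn: "0 \<le> R 0" "0 \<le> norm ys + 1" using order_trans[OF qr_nonneg qr_le_R] by auto
  obtain \<rho> a where \<rho>: "0 < \<rho>" "0 < a"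
    and acc: "\<And>x y \<alpha> z q. dist x xs < \<rho> \<Longrightarrow> norm y \<le> norm ys + 1 \<Longrightarrow> feas x y \<Longrightarrow> Qr x y \<le> R 0 \<Longrightarrow>
      Qr x y \<le> q \<Longrightarrow> 0 < \<alpha> \<Longrightarrow> \<alpha> \<le> a \<Longrightarrow> z \<in> prox_step j \<alpha> (Qr x y) x y \<Longrightarrow>
      accepts f g h \<sigma> (ereal q) x y (replace_block (B j) z x)"
    by (rule line_search_accepts_near[OF j xs_D nn]) (rule that)
  \<comment> \<open>An accepted step below \<open>\<alpha>lo\<close> has a rejected predecessor
    \<open>\<alpha> k / \<gamma>\<close>. Near \<open>xs\<close> every step up to \<open>a\<close>
    is accepted, so that predecessor exceeds \<open>a\<close>.\<close>
  define amin where "amin = min \<alpha>lo (\<gamma> * a)"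
  have amin: "0 < amin" using \<rho> \<alpha>lo \<gamma> by (simp add: amin_def)
  have "\<forall>\<^sub>F k in sequentially. amin \<le> \<alpha> k"
  proof -
    have "\<forall>\<^sub>F k in sequentially. norm (y (r k)) < norm ys + 1"
      by (rule order_tendstoD(2)[OF tendsto_norm[OF l(2)]]) simp
    moreover have "\<forall>\<^sub>F k in sequentially. dist (x (r k)) xs < \<rho>" using tendstoD[OF l(1) \<rho>(1)] .
    ultimately show ?thesis
    proof eventually_elim
      case (elim k)
      show ?case
      proof (rule ccontr)
        assume "\<not> amin \<le> \<alpha> k"
        then have "\<alpha> k < \<alpha>lo" "\<alpha> k / \<gamma> \<le> a" using \<gamma> by (auto simp: amin_def field_simps)
        moreover have "Qr (x (r k)) (y (r k)) \<le> R 0"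
          using qr_le_R[of "r k"] decseqD[OF R_decseq, of 0 "r k"] by (simp add: qr_def)
        moreover obtain z' where z': "z' \<in> prox_step j (\<alpha> k / \<gamma>) (qr (r k)) (x (r k)) (y (r k))"
          "\<not> accepts f g h \<sigma> (ereal (R (r k))) (x (r k)) (y (r k)) (replace_block (B j) z' (x (r k)))"
          using bt[of k] \<open>\<alpha> k < \<alpha>lo\<close> by auto
        moreover have "0 < \<alpha> k / \<gamma>" using \<alpha>[of k] \<gamma> by simp
        ultimately show False
          using acc[OF elim(2) less_imp_le[OF elim(1)] feas_run, of "R (r k)" "\<alpha> k / \<gamma>" z'] qr_le_R[of "r k"]
          by (simp add: qr_def)
      qed
    qed
  qed
  moreover have "(\<lambda>k. z k - subvec (B j) (x (r k))) \<longlonglongrightarrow> 0"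
    using d0 replace_block_diff[OF prox_step_ineq(1)[OF j xf \<alpha> z]] by (simp add: x')
  ultimately have "fbr j (subvec (B j) xs) \<le> fbr j w + (grad h xs - Rs *\<^sub>R ys) \<bullet> (w - subvec (B j) xs)
      + 1 / (2 * amin) * (norm (w - subvec (B j) xs))\<^sup>2"
    if "w \<in> coord_space (B j)" "fb j w \<noteq> \<infinity>" for w
    by (intro prox_step_limit[OF j xs_D l(1) xf l(2) qr amin _ z _ that])
  then show ?thesis using amin by (intro that[of "1 / (2 * amin)"]) auto
qed

text \<open>When \<open>Rs = 0\<close> nothing is known about \<open>ys\<close>, but
  \<open>F\<close> vanishes at \<open>xs\<close>, so any subgradient of \<open>g\<close> serves and
  both scaled vectors are zero. When \<open>Rs > 0\<close> the vector \<open>ys\<close> itself is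
  the subgradient.\<close>

lemma critical:
  shows critical_point: "critical_point f g h xs"
    and scaled_subgradient: "real_of_ereal (Fobj f g h xs) *\<^sub>R ys
      \<in> (\<lambda>v. real_of_ereal (Fobj f g h xs) *\<^sub>R v) ` subdiff g xs"
proof -
  have F: "real_of_ereal (Fobj f g h xs) = Z xs / g xs" by (simp add: Fobj_eq[OF xs_D])
  have "\<exists>u\<in>frechet_subdiff f xs. \<exists>v\<in>subdiff g xs.
      (Z xs / g xs) *\<^sub>R ys = (Z xs / g xs) *\<^sub>R v \<and> u + grad h xs - (Z xs / g xs) *\<^sub>R v = 0"
  proof (cases "Rs = 0")
    case True
    then have "Z xs = 0" using F_le_Rs Z_nonneg[OF xs_D] g_pos[OF xs_D] by (simp add: divide_le_0_iff)
    moreover obtain v where "v \<in> subdiff g xs" using subgradient_exists[OF g_convex] by blast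
    ultimately show ?thesis using frechet_of_zero[OF xs_D] by force
  next
    case False
    then have Rs_pos: "0 < Rs" using Rs_nonneg by simp
    define A where "A j c \<longleftrightarrow> 0 \<le> c \<and> (\<forall>w\<in>coord_space (B j). fb j w \<noteq> \<infinity> \<longrightarrow>
      fbr j (subvec (B j) xs) \<le> fbr j w + (grad h xs - Rs *\<^sub>R ys) \<bullet> (w - subvec (B j) xs)
      + c * (norm (w - subvec (B j) xs))\<^sup>2)" for j c
    have "\<exists>c. A j c" if "j \<in> {1..N}" for j
      unfolding A_def by (rule block_stationary[OF Rs_pos that]) blast
    then obtain C where "\<And>j. j \<in> {1..N} \<Longrightarrow> A j (C j)" by metis
    then have C: "\<And>j. j \<in> {1..N} \<Longrightarrow> 0 \<le> C j" "\<And>j w. j \<in> {1..N} \<Longrightarrow> w \<in> coord_space (B j) \<Longrightarrow>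
      fb j w \<noteq> \<infinity> \<Longrightarrow> fbr j (subvec (B j) xs) \<le> fbr j w + (grad h xs - Rs *\<^sub>R ys) \<bullet> (w - subvec (B j) xs)
      + C j * (norm (w - subvec (B j) xs))\<^sup>2"
      unfolding A_def by blast+
    have "Rs *\<^sub>R ys - grad h xs \<in> frechet_subdiff f xs"
    proof (rule frechet_of_blocks[OF _ C(1)])
      show "xs \<in> edom f" using xs_D by (simp add: D_def)
    qed (use C(2) in \<open>force simp: inner_diff_left\<close>)+
    then show ?thesis using limit_values[OF Rs_pos] by force
  qed
  then obtain u v where uv: "u \<in> frechet_subdiff f xs" "v \<in> subdiff g xs"
    "(Z xs / g xs) *\<^sub>R ys = (Z xs / g xs) *\<^sub>R v" "0 = u + grad h xs - (Z xs / g xs) *\<^sub>R v"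
    by force
  show "critical_point f g h xs"
    unfolding critical_point_def F edom_Fobj using xs_D uv by blast
  show "real_of_ereal (Fobj f g h xs) *\<^sub>R ys
      \<in> (\<lambda>v. real_of_ereal (Fobj f g h xs) *\<^sub>R v) ` subdiff g xs"
    unfolding F using uv by blast
qed

end

end

theorem theorem5p3:
  fixes f h :: "real^'n \<Rightarrow> ereal" and g :: "real^'n \<Rightarrow> real"
    and N m :: nat and B :: "nat \<Rightarrow> 'n set" and fb :: "nat \<Rightarrow> real^'n \<Rightarrow> ereal"
    and \<alpha>lo \<alpha>hi \<sigma> \<gamma> p_min :: real and x0 y0 :: "real^'n"
    and P :: "'w measure" and \<F> :: "nat \<Rightarrow> 'w measure" and p :: "nat \<Rightarrow> nat \<Rightarrow> real"
    and i :: "nat \<Rightarrow> 'w \<Rightarrow> nat" and x y :: "nat \<Rightarrow> 'w \<Rightarrow> real^'n"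
  assumes "proper_on UNIV f" "lsc_on UNIV f"
    and "proper_on UNIV h" "lsc_on UNIV h"
    and "lsc_on UNIV (\<lambda>u. ereal (g u))"
    and "Omega g \<noteq> {}"
    and "coord_partition N B"
    and "\<And>u. f u = (\<Sum>j\<in>{1..N}. fb j (subvec (B j) u))"
    and "\<And>j. j \<in> {1..N} \<Longrightarrow> proper_on (coord_space (B j)) (fb j)"
    and "\<And>j. j \<in> {1..N} \<Longrightarrow> lsc_on (coord_space (B j)) (fb j)"
    and "continuous_on (edom f) f"
    and "\<And>j. j \<in> {1..N} \<Longrightarrow> \<exists>c::real. \<forall>z\<in>coord_space (B j). ereal c \<le> fb j z"
    and "loc_lipschitz_differentiable_on (Omega g) h"
    and "convex_on UNIV g" "\<And>u. 0 \<le> g u"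
    and "\<And>u. u \<in> edom f \<Longrightarrow> 0 \<le> f u + h u"
    and "x0 \<in> edom (Fobj f g h)" "y0 \<in> subdiff g x0"
    and "0 < \<alpha>lo" "\<alpha>lo \<le> \<alpha>hi" "0 < \<sigma>" "0 < \<gamma>" "\<gamma> < 1"
    and "prob_space P"
    and "0 < p_min" "\<And>t j. j \<in> {0..N} \<Longrightarrow> p_min \<le> p t j" "\<And>t. (\<Sum>j\<in>{0..N}. p t j) = 1"
    and "RMPGA_process P \<F> N p i x y"
    and "\<And>\<omega>. \<omega> \<in> space P \<Longrightarrow>
           MPGA_run N B fb f g h \<alpha>lo \<alpha>hi \<sigma> \<gamma> m x0 y0 (\<lambda>t. i t \<omega>) (\<lambda>t. x t \<omega>) (\<lambda>t. y t \<omega>)"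
    and "compact {u. Fobj f g h u \<le> Fobj f g h x0}"
  shows "AE \<omega> in P. \<forall>xs ys.
           (\<exists>r. strict_mono r \<and> (\<lambda>k. (x (r k) \<omega>, y (r k) \<omega>)) \<longlonglongrightarrow> (xs, ys)) \<longrightarrow>
           xs \<in> edom (Fobj f g h) \<and> critical_point f g h xs \<and>
           real_of_ereal (Fobj f g h xs) *\<^sub>R ys
             \<in> (\<lambda>v. real_of_ereal (Fobj f g h xs) *\<^sub>R v) ` subdiff g xs"
proof -
  interpret prob_space P by fact
  interpret fractional_program f h g N B fb \<sigma>
    using assms by unfold_locales auto
  have filt: "filtration (space P) \<F>" and sub: "\<And>t. subalgebra P (\<F> t)"
    and mx: "\<And>t. x t \<in> borel_measurable (\<F> t)" and my: "\<And>t. y t \<in> borel_measurable (\<F> t)"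
    and mi: "\<And>t. i t \<in> measurable (\<F> (Suc t)) (count_space UNIV)"
    and ce: "\<And>t j. j \<in> {0..N} \<Longrightarrow> AE \<omega> in P.
      real_cond_exp P (\<F> t) (indicator {\<omega>' \<in> space P. i t \<omega>' = j}) \<omega> = p t j"
    using \<open>RMPGA_process P \<F> N p i x y\<close> unfolding RMPGA_process_def by blast+
  have space: "space (\<F> t) = space P" for t using sub by (simp add: subalgebra_def)
  \<comment> \<open>Pick \<open>j\<close> followed by \<open>m\<close> zeros when \<open>k\<close>
    runs through \<open>0..m\<close>; the matching pattern length is \<open>Suc m\<close>.\<close>
  define pick where "pick j k = (if k = 0 then j else 0)" for j k :: nat
  \<comment> \<open>The countable basis lets one null set serve all accumulation points at once,
    although these are uncountably many and depend on \<omega>.\<close>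
  obtain \<B> :: "((real^'n) \<times> (real^'n)) set set" where \<B>: "countable \<B>" "topological_basis \<B>"
    using ex_countable_basis by blast
  have rec: "AE \<omega> in P. (\<exists>\<^sub>\<infinity>t. (x t \<omega>, y t \<omega>) \<in> U) \<longrightarrow>
      (\<exists>\<^sub>\<infinity>t. (x t \<omega>, y t \<omega>) \<in> U \<and> (\<forall>k<Suc m. i (t + k) \<omega> = pick j k))"
    if U: "U \<in> \<B>" and j: "j \<in> {0..N}" for U j
  proof -
    define E where "E t = {\<omega> \<in> space P. (x t \<omega>, y t \<omega>) \<in> U}" for t
    define S where "S k t = {\<omega> \<in> space P. i t \<omega> = pick j k}" for k t
    have pickN: "pick j k \<in> {0..N}" for k using j by (simp add: pick_def)
    have "AE \<omega> in P. (\<exists>\<^sub>\<infinity>t. \<omega> \<in> E t) \<longrightarrow> (\<exists>\<^sub>\<infinity>t. \<omega> \<in> E t \<and> (\<forall>k<Suc m. \<omega> \<in> S k (t + k)))"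
    proof (rule AE_trials_imp_successive_successes[where \<F> = \<F> and p = p_min])
      show "sets (\<F> s) \<subseteq> sets (\<F> t)" if "s \<le> t" for s t
        using filtration.sets_F_mono[OF filt that] .
      fix t
      have "(\<lambda>\<omega>. (x t \<omega>, y t \<omega>)) \<in> borel_measurable (\<F> t)" using mx my by (intro borel_measurable_Pair)
      moreover have "U \<in> sets borel" using topological_basis_open[OF \<B>(2) U] by (rule borel_open)
      ultimately show "E t \<in> sets (\<F> t)"
        using measurable_sets[of "\<lambda>\<omega>. (x t \<omega>, y t \<omega>)" "\<F> t" borel U] by (simp add: E_def space vimage_def Int_def conj_commute)
      fix k
      show "S k t \<in> sets (\<F> (Suc t))"
        using measurable_sets[OF mi, of "{pick j k}" t] by (simp add: S_def space vimage_def Int_def conj_commute)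
      show "AE \<omega> in P. p_min \<le> real_cond_exp P (\<F> t) (indicator (S k t)) \<omega>"
        using ce[OF pickN, of t k]
        by eventually_elim (use assms(26)[OF pickN] in \<open>simp add: S_def\<close>)
    qed (use sub \<open>0 < p_min\<close> in auto)
    then show ?thesis
      using AE_space by eventually_elim (simp add: E_def S_def)
  qed
  have "AE \<omega> in P. \<forall>U\<in>\<B>. \<forall>j\<in>{0..N}. (\<exists>\<^sub>\<infinity>t. (x t \<omega>, y t \<omega>) \<in> U) \<longrightarrow>
      (\<exists>\<^sub>\<infinity>t. (x t \<omega>, y t \<omega>) \<in> U \<and> (\<forall>k<Suc m. i (t + k) \<omega> = pick j k))"
    using \<B>(1) rec by (intro AE_ball_countable[THEN iffD2] ballI) auto
  then show ?thesis
    using AE_space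
  proof eventually_elim
    case (elim \<omega>)
    interpret run: mpga f h g N B fb \<sigma> \<alpha>lo \<alpha>hi \<gamma> m x0 y0 "\<lambda>t. i t \<omega>" "\<lambda>t. x t \<omega>" "\<lambda>t. y t \<omega>"
      using assms elim(2) by unfold_locales auto
    obtain Rs where Rs: "run.R \<longlonglongrightarrow> Rs" by (rule run.R_convergent)
    show ?case
    proof (intro allI impI)
      fix xs ys
      assume "\<exists>r. strict_mono r \<and> (\<lambda>k. (x (r k) \<omega>, y (r k) \<omega>)) \<longlonglongrightarrow> (xs, ys)"
      then obtain r where r: "strict_mono r" "(\<lambda>k. (x (r k) \<omega>, y (r k) \<omega>)) \<longlonglongrightarrow> (xs, ys)" by blast
      have good: "\<exists>r. run.good_subseq xs ys j r" if j: "j \<in> {0..N}" for j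
      proof -
        \<comment> \<open>The pattern recurs inside ever smaller basic neighbourhoods of the limit;
          choosing increasing times, one for each radius, yields the good subsequence.\<close>
        define A where "A n t \<longleftrightarrow> dist (x t \<omega>, y t \<omega>) (xs, ys) < inverse (real (Suc n)) \<and>
          (\<forall>k<Suc m. i (t + k) \<omega> = pick j k)" for n t
        have inf: "\<exists>\<^sub>\<infinity>t. A n t" for n
        proof -
          obtain U where U: "U \<in> \<B>" "(xs, ys) \<in> U" "U \<subseteq> ball (xs, ys) (inverse (real (Suc n)))"
            using topological_basisE[OF \<B>(2), of "ball (xs, ys) (inverse (real (Suc n)))" "(xs, ys)"]
            by (metis centre_in_ball inverse_positive_iff_positive of_nat_0_less_iff open_ball zero_less_Suc)
          have "\<forall>\<^sub>F k in sequentially. (x (r k) \<omega>, y (r k) \<omega>) \<in> U"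
            using topological_tendstoD[OF r(2) topological_basis_open[OF \<B>(2) U(1)] U(2)] .
          then obtain K where K: "\<And>k. k \<ge> K \<Longrightarrow> (x (r k) \<omega>, y (r k) \<omega>) \<in> U"
            unfolding eventually_sequentially by blast
          have "\<exists>\<^sub>\<infinity>t. (x t \<omega>, y t \<omega>) \<in> U"
            unfolding INFM_nat_le
          proof
            fix n
            show "\<exists>t\<ge>n. (x t \<omega>, y t \<omega>) \<in> U"
              using K[of "max n K"] seq_suble[OF r(1), of "max n K"] by (intro exI[of _ "r (max n K)"]) auto
          qed
          then have "\<exists>\<^sub>\<infinity>t. (x t \<omega>, y t \<omega>) \<in> U \<and> (\<forall>k<Suc m. i (t + k) \<omega> = pick j k)"
            using elim(1) U(1) j by blast
          then show ?thesis
            by (rule frequently_elim1) (use U(3) in \<open>auto simp: A_def dist_commute\<close>)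
        qed
        have "\<exists>r. \<forall>n. A n (r n) \<and> r n < r (Suc n)"
        proof (rule dependent_nat_choice)
          show "\<exists>t. A 0 t" using inf by (rule INFM_EX)
          show "\<exists>t'. A (Suc n) t' \<and> t < t'" for t n using inf[of "Suc n"] unfolding INFM_nat by blast
        qed
        then obtain q where q: "\<And>n. A n (q n)" "strict_mono q" by (auto simp: strict_mono_Suc_iff)
        have "(\<lambda>n. (x (q n) \<omega>, y (q n) \<omega>)) \<longlonglongrightarrow> (xs, ys)"
        proof (rule metric_LIMSEQ_I)
          fix e :: real assume "0 < e"
          then obtain n0 where n0: "inverse (real (Suc n0)) < e" using reals_Archimedean by blast
          have "dist (x (q n) \<omega>, y (q n) \<omega>) (xs, ys) < e" if "n \<ge> n0" for n
          proof -
            have "inverse (real (Suc n)) \<le> inverse (real (Suc n0))" using that by simp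
            moreover have "dist (x (q n) \<omega>, y (q n) \<omega>) (xs, ys) < inverse (real (Suc n))"
              using q(1) unfolding A_def by blast
            ultimately show ?thesis using n0 by linarith
          qed
          then show "\<exists>n0. \<forall>n\<ge>n0. dist (x (q n) \<omega>, y (q n) \<omega>) (xs, ys) < e" by blast
        qed
        then have "(\<lambda>n. x (q n) \<omega>) \<longlonglongrightarrow> xs" "(\<lambda>n. y (q n) \<omega>) \<longlonglongrightarrow> ys"
          using tendsto_fst tendsto_snd by fastforce+
        moreover have "i (q n) \<omega> = j" for n
          using q(1)[of n] by (auto simp: A_def pick_def)
        moreover have "i (q n + s) \<omega> = 0" if "s \<in> {1..m}" for n s
          using q(1)[of n] that by (auto simp: A_def pick_def)
        ultimately show ?thesis using q(2) unfolding run.good_subseq_def by blast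
      qed
      note c = \<open>compact {u. Fobj f g h u \<le> Fobj f g h x0}\<close>
      show "xs \<in> edom (Fobj f g h) \<and> critical_point f g h xs \<and>
           real_of_ereal (Fobj f g h xs) *\<^sub>R ys
             \<in> (\<lambda>v. real_of_ereal (Fobj f g h xs) *\<^sub>R v) ` subdiff g xs"
        using run.critical[OF c good Rs] by (simp add: critical_point_def)
    qed
  qed
qed

end
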